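(* The degree structures $\mathcal D^1_{<\omega}$, $\mathcal D^1_{\omega|<\omega}$, $\mathcal D^{<\omega}_1$, $\mathcal P^1_{<\omega}$, $\mathcal P^1_{\omega|<\omega}$, and $\mathcal P^{<\omega}_1$ are not Brouwerian.
   Context: Let $\{\Phi_e\}_{e\in\mathbb N}$ be an effective enumeration of all partial computable functions $\Phi_e:\subseteq\mathbb N^{\mathbb N}\to\mathbb N^{\mathbb N}$. A learner is a total computable function $\Psi:\mathbb N^{<\mathbb N}\to\mathbb N$. A partial function $\Gamma:\subseteq\mathbb N^{\mathbb N}\to\mathbb N^{\mathbb N}$ is identified by $\Psi$ if for every $g\in\mathrm{dom}(\Gamma)$ the limit $\lim_n\Psi(g\upharpoonright n)$ exists and $\Phi_{\lim_n\Psi(g\upharpoonright n)}(g)=\Gamma(g)$. $\Gamma$ is $(1,<\omega)$-computable if it is identified by a learner $\Psi$ with $\sup_{g\in\mathrm{dom}(\Gamma)}\#\{n:\Psi(g\upharpoonright (n+1))\neq\Psi(g\upharpoonright n)\}<\omega$. $\Gamma$ is $(1,\omega|<\omega)$-computable if it is identified by a learner $\Psi$ with $\sup_{g\in\mathrm{dom}(\Gamma)}\#\{\Psi(g\upharpoonright n):n\in\mathbb N\}<\omega$. $\Gamma$ is $(<\omega,1)$-computable if there is $b\in\mathbb N$ such that for every $g\in\mathrm{dom}(\Gamma)$, $\Gamma(g)=\Phi_e(g)$ for some $e<b$. For each of these notions, written $(\alpha,\beta|\gamma)$ (or $(\alpha,\beta)$), and $A,B\subseteq\mathbb N^{\mathbb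 N}$, $A\le^\alpha_{\beta|\gamma}B$ means there is a partial function $\Gamma$ computable in that sense with $B\subseteq\mathrm{dom}(\Gamma)$ and $\Gamma(g)\in A$ for every $g\in B$. $\mathcal D^\alpha_{\beta|\gamma}$ is the partial order obtained by quotienting the set of all subsets of $\mathbb N^{\mathbb N}$, preordered by $\le^\alpha_{\beta|\gamma}$, by the induced equivalence; $\mathcal P^\alpha_{\beta|\gamma}$ is obtained in the same way from the set of all nonempty $\Pi^0_1$ subsets of $2^{\mathbb N}$. In these structures the join of the degrees of $A$ and $B$ is the degree of $A\otimes B=\{f\oplus g:f\in A,\ g\in B\}$, where $(f\oplus g)(2n)=f(n)$, $(f\oplus g)(2n+1)=g(n)$. Such a structure is Brouwerian if for all elements $p,q$ there is a least element $r$ such that $p\le q\vee r$. *)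

theory Defs
  imports "HOL-Library.Nat_Bijection" "HOL-Library.Sublist" "HOL-Algebra.Order"
begin

section \<open>Oracle computability\<close>

type_synonym baire = "nat \<Rightarrow> nat"

text \<open>
  Programs for the unary partial recursive functions relative to an oracle. Functions of several
  arguments are rendered by the pairing bijection \<^const>\<open>prod_encode\<close>.
\<close>

datatype oprog =
    Zero | Succ | Fst | Snd | Oracle
  | Pairing oprog oprog
  | Comp oprog oprog
  | Prec oprog oprog
  | Mu oprog

text \<open>
  In the last equation the condition on \<open>n\<close> forces the values at all \<open>m < n\<close> to be defined;
  the least such \<open>n\<close> is therefore the result of the unbounded search.
\<close>

primrec run :: "oprog \<Rightarrow> baire \<Rightarrow> nat \<Rightarrow> nat option" where
  "run Zero g x = Some 0"
| "run Succ g x = Some (Suc x)"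
| "run Fst g x = Some (fst (prod_decode x))"
| "run Snd g x = Some (snd (prod_decode x))"
| "run Oracle g x = Some (g x)"
| "run (Pairing p q) g x =
    Option.bind (run p g x) (\<lambda>a. Option.bind (run q g x) (\<lambda>b. Some (prod_encode (a, b))))"
| "run (Comp p q) g x = Option.bind (run q g x) (run p g)"
| "run (Prec p q) g x = (case prod_decode x of (a, n) \<Rightarrow>
    rec_nat (run p g a)
      (\<lambda>k r. Option.bind r (\<lambda>v. run q g (prod_encode (a, prod_encode (k, v))))) n)"
| "run (Mu p) g x =
    (let hit = (\<lambda>n. run p g (prod_encode (x, n)) = Some 0 \<and>
                    (\<forall>m<n. run p g (prod_encode (x, m)) \<noteq> None))
     in if \<exists>n. hit n then Some (LEAST n. hit n) else None)"

definition functional :: "oprog \<Rightarrow> baire \<rightharpoonup> baire" where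
  "functional p g =
    (if \<forall>n. run p g n \<noteq> None then Some (\<lambda>n. the (run p g n)) else None)"

lemma prod_decode_fst_le: "fst (prod_decode m) \<le> m"
  by (metis le_prod_encode_1 prod.collapse prod_decode_inverse)

lemma prod_decode_snd_le: "snd (prod_decode m) \<le> m"
  by (metis le_prod_encode_2 prod.collapse prod_decode_inverse)

text \<open>A Goedel numbering: every number is the code of exactly one program.\<close>

function prog :: "nat \<Rightarrow> oprog" where
  "prog e =
    (if e = 0 then Zero else if e = 1 then Succ else if e = 2 then Fst
     else if e = 3 then Snd else if e = 4 then Oracle
     else let m = (e - 5) div 4; a = fst (prod_decode m); b = snd (prod_decode m) in
       if (e - 5) mod 4 = 0 then Pairing (prog a) (prog b)
       else if (e - 5) mod 4 = 1 then Comp (prog a) (prog b)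
       else if (e - 5) mod 4 = 2 then Prec (prog a) (prog b)
       else Mu (prog m))"
  by pat_completeness auto
termination
proof -
  have div_less: "(e - 5) div 4 < e" if "e \<noteq> 0" for e :: nat
  proof -
    have "(e - 5) div 4 \<le> e - 5" by (rule div_le_dividend)
    then show ?thesis using that by linarith
  qed
  show ?thesis
    by (relation "measure id")
      (simp_all add: div_less le_less_trans[OF prod_decode_fst_le div_less]
        le_less_trans[OF prod_decode_snd_le div_less])
qed

declare prog.simps [simp del]

primrec code :: "oprog \<Rightarrow> nat" where
  "code Zero = 0"
| "code Succ = 1"
| "code Fst = 2"
| "code Snd = 3"
| "code Oracle = 4"
| "code (Pairing p q) = 5 + 4 * prod_encode (code p, code q)"
| "code (Comp p q) = 6 + 4 * prod_encode (code p, code q)"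
| "code (Prec p q) = 7 + 4 * prod_encode (code p, code q)"
| "code (Mu p) = 8 + 4 * code p"

lemma prog_base:
  "prog 0 = Zero" "prog 1 = Succ" "prog 2 = Fst" "prog 3 = Snd" "prog 4 = Oracle"
  by (simp_all only: prog.simps[of 0] prog.simps[of 1] prog.simps[of 2] prog.simps[of 3]
      prog.simps[of 4]) simp_all

lemma prog_step:
  "prog (5 + 4 * m) = Pairing (prog (fst (prod_decode m))) (prog (snd (prod_decode m)))"
  "prog (6 + 4 * m) = Comp (prog (fst (prod_decode m))) (prog (snd (prod_decode m)))"
  "prog (7 + 4 * m) = Prec (prog (fst (prod_decode m))) (prog (snd (prod_decode m)))"
  "prog (8 + 4 * m) = Mu (prog m)"
proof -
  have digit: "r + 5 + 4 * m - 5 = r + 4 * m" "(r + 4 * m) mod 4 = r" "(r + 4 * m) div 4 = m"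
    if "r < 4" for r :: nat
    using that by simp_all
  show "prog (5 + 4 * m) = Pairing (prog (fst (prod_decode m))) (prog (snd (prod_decode m)))"
    using digit[of 0] by (subst prog.simps) simp
  show "prog (6 + 4 * m) = Comp (prog (fst (prod_decode m))) (prog (snd (prod_decode m)))"
    using digit[of 1] by (subst prog.simps) simp
  show "prog (7 + 4 * m) = Prec (prog (fst (prod_decode m))) (prog (snd (prod_decode m)))"
    using digit[of 2] by (subst prog.simps) simp
  show "prog (8 + 4 * m) = Mu (prog m)"
    using digit[of 3] by (subst prog.simps) simp
qed

lemma prog_code [simp]: "prog (code p) = p"
  by (induction p) (simp_all only: code.simps prog_base prog_step prod_encode_inverse fst_conv snd_conv)

lemma code_prog [simp]: "code (prog e) = e"
proof (induction e rule: less_induct)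
  case (less e)
  define m where "m = (e - 5) div 4"
  show ?case
  proof (cases "e < 5")
    case True
    then have "e = 0 \<or> e = 1 \<or> e = 2 \<or> e = 3 \<or> e = 4" by linarith
    then show ?thesis by (elim disjE) (simp_all only: prog_base code.simps)
  next
    case False
    have "e - 5 = 4 * m + (e - 5) mod 4" "(e - 5) mod 4 < 4"
      unfolding m_def by simp_all
    with False have lt: "m < e"
      and cases: "e = 5 + 4 * m \<or> e = 6 + 4 * m \<or> e = 7 + 4 * m \<or> e = 8 + 4 * m"
      by linarith+
    have "code (prog (fst (prod_decode m))) = fst (prod_decode m)"
         "code (prog (snd (prod_decode m))) = snd (prod_decode m)"
         "code (prog m) = m"
      using less lt le_less_trans[OF prod_decode_fst_le lt] le_less_trans[OF prod_decode_snd_le lt]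
      by blast+
    with cases show ?thesis
      by (elim disjE) (simp_all only: prog_step code.simps prod.collapse prod_decode_inverse)
  qed
qed

lemma bij_prog: "bij prog"
  by (rule bij_betw_byWitness[where f' = code]) simp_all

definition Phi :: "nat \<Rightarrow> baire \<rightharpoonup> baire" where
  "Phi e = functional (prog e)"

lemma range_Phi: "range Phi = range functional"
  using bij_prog unfolding Phi_def bij_def by (metis image_image)

text \<open>
  Strings are coded by the bijection \<^const>\<open>list_encode\<close>; the constant zero oracle yields
  computability without an oracle.
\<close>

definition computable_on_strings :: "(nat list \<Rightarrow> nat) \<Rightarrow> bool" where
  "computable_on_strings \<Psi> \<longleftrightarrow>
    (\<exists>p. \<forall>\<sigma>. run p (\<lambda>_. 0) (list_encode \<sigma>) = Some (\<Psi> \<sigma>))"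

definition initial :: "baire \<Rightarrow> nat \<Rightarrow> nat list"  (infixl "\<restriction>" 90) where
  "g \<restriction> n = map g [0..<n]"


section \<open>Learners and nonuniform computability\<close>

definition identified_by :: "(baire \<rightharpoonup> baire) \<Rightarrow> (nat list \<Rightarrow> nat) \<Rightarrow> bool" where
  "identified_by \<Gamma> \<Psi> \<longleftrightarrow>
    (\<forall>g\<in>dom \<Gamma>. \<exists>e. (\<exists>m. \<forall>n\<ge>m. \<Psi> (g \<restriction> n) = e) \<and> Phi e g = \<Gamma> g)"

definition mind_changes :: "(nat list \<Rightarrow> nat) \<Rightarrow> baire \<Rightarrow> nat set" where
  "mind_changes \<Psi> g = {n. \<Psi> (g \<restriction> (n + 1)) \<noteq> \<Psi> (g \<restriction> n)}"

definition guesses :: "(nat list \<Rightarrow> nat) \<Rightarrow> baire \<Rightarrow> nat set" where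
  "guesses \<Psi> g = {\<Psi> (g \<restriction> n) | n. True}"

text \<open>\<open>(1,<\<omega>)\<close>-computability\<close>

definition comp_bounded_changes :: "(baire \<rightharpoonup> baire) \<Rightarrow> bool" where
  "comp_bounded_changes \<Gamma> \<longleftrightarrow>
    (\<exists>\<Psi>. computable_on_strings \<Psi> \<and> identified_by \<Gamma> \<Psi> \<and>
         (\<exists>k. \<forall>g\<in>dom \<Gamma>. finite (mind_changes \<Psi> g) \<and> card (mind_changes \<Psi> g) \<le> k))"

text \<open>\<open>(1,\<omega>|<\<omega>)\<close>-computability\<close>

definition comp_bounded_guesses :: "(baire \<rightharpoonup> baire) \<Rightarrow> bool" where
  "comp_bounded_guesses \<Gamma> \<longleftrightarrow>
    (\<exists>\<Psi>. computable_on_strings \<Psi> \<and> identified_by \<Gamma> \<Psi> \<and>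
         (\<exists>k. \<forall>g\<in>dom \<Gamma>. finite (guesses \<Psi> g) \<and> card (guesses \<Psi> g) \<le> k))"

text \<open>\<open>(<\<omega>,1)\<close>-computability\<close>

definition comp_finitely_many :: "(baire \<rightharpoonup> baire) \<Rightarrow> bool" where
  "comp_finitely_many \<Gamma> \<longleftrightarrow> (\<exists>b. \<forall>g\<in>dom \<Gamma>. \<exists>e<b. \<Gamma> g = Phi e g)"

definition reducible :: "((baire \<rightharpoonup> baire) \<Rightarrow> bool) \<Rightarrow> baire set \<Rightarrow> baire set \<Rightarrow> bool" where
  "reducible C A B \<longleftrightarrow> (\<exists>\<Gamma>. C \<Gamma> \<and> B \<subseteq> dom \<Gamma> \<and> (\<forall>g\<in>B. the (\<Gamma> g) \<in> A))"


section \<open>Degree structures\<close>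

definition interleave :: "baire \<Rightarrow> baire \<Rightarrow> baire" where
  "interleave f g = (\<lambda>n. if even n then f (n div 2) else g (n div 2))"

definition tensor :: "baire set \<Rightarrow> baire set \<Rightarrow> baire set" where
  "tensor A B = {interleave f g | f g. f \<in> A \<and> g \<in> B}"

definition computable_tree :: "nat list set \<Rightarrow> bool" where
  "computable_tree T \<longleftrightarrow>
    computable_on_strings (\<lambda>\<sigma>. of_bool (\<sigma> \<in> T)) \<and> (\<forall>\<sigma>\<in>T. \<forall>\<tau>. prefix \<tau> \<sigma> \<longrightarrow> \<tau> \<in> T)"

text \<open>Cantor space is the set of all \<open>f :: baire\<close> with values in \<open>{0, 1}\<close>.\<close>

definition Pi01_class :: "baire set \<Rightarrow> bool" where
  "Pi01_class P \<longleftrightarrow>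
    (\<exists>T. computable_tree T \<and> (\<forall>\<sigma>\<in>T. set \<sigma> \<subseteq> {0, 1}) \<and> P = {f. \<forall>n. f \<restriction> n \<in> T})"

definition equiv_rel :: "'a set \<Rightarrow> ('a \<Rightarrow> 'a \<Rightarrow> bool) \<Rightarrow> ('a \<times> 'a) set" where
  "equiv_rel X R = {(A, B). A \<in> X \<and> B \<in> X \<and> R A B \<and> R B A}"

record 'a join_order = "'a gorder" +
  vee :: "'a \<Rightarrow> 'a \<Rightarrow> 'a"

text \<open>
  The union in the last component is the union of the degrees of \<open>tensor A B\<close> over all choices of
  representatives, all of which coincide.
\<close>

definition degree_structure ::
    "baire set set \<Rightarrow> ((baire \<rightharpoonup> baire) \<Rightarrow> bool) \<Rightarrow> baire set set join_order" where
  "degree_structure X C =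
    \<lparr>carrier = X // equiv_rel X (reducible C),
     eq = (=),
     le = (\<lambda>p q. \<exists>A\<in>p. \<exists>B\<in>q. reducible C A B),
     vee = (\<lambda>p q. \<Union>A\<in>p. \<Union>B\<in>q. equiv_rel X (reducible C) `` {tensor A B})\<rparr>"

definition D_degrees :: "((baire \<rightharpoonup> baire) \<Rightarrow> bool) \<Rightarrow> baire set set join_order" where
  "D_degrees C = degree_structure UNIV C"

definition P_degrees :: "((baire \<rightharpoonup> baire) \<Rightarrow> bool) \<Rightarrow> baire set set join_order" where
  "P_degrees C = degree_structure {P. Pi01_class P \<and> P \<noteq> {}} C"

definition Brouwerian :: "('a, 'b) join_order_scheme \<Rightarrow> bool" where
  "Brouwerian L \<longleftrightarrow>
    (\<forall>p\<in>carrier L. \<forall>q\<in>carrier L. \<exists>r. least L r {r \<in> carrier L. p \<sqsubseteq>\<^bsub>L\<^esub> vee L q r})"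

end

theory Submission
  imports Defs
begin

text \<open>
  A finite injury construction gives a set \<open>X\<close> and c.e. sets of forced bits such that no element of
  the \<open>\<Pi>\<^sup>0\<^sub>1\<close> class \<open>S\<^sub>i\<close> of all sets that respect the forced bits of column \<open>i\<close> is computable from the
  other columns of \<open>X\<close>, although column \<open>i\<close> of \<open>X\<close> belongs to \<open>S\<^sub>i\<close>. Relabel the columns as one column
  \<open>k\<close>, columns \<open>a\<^sub>n\<close> and columns \<open>(n, m)\<close>.

  An element of \<open>Q\<close> consists, for every \<open>n\<close>, of an element of \<open>S\<close> for \<open>(n, m)\<close>, where \<open>m \<le> n\<close> starts at \<open>0\<close>
  and may grow while the element is being written down. An element of \<open>P\<close> names some \<open>n\<close>, an element of
  \<open>S\<close> for \<open>a\<^sub>n\<close>, some \<open>m \<le> n\<close> and an element of \<open>S\<close> for \<open>(n, m)\<close>; as the naming of \<open>n\<close> may be postponed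
  for ever, the limit case is filled with the elements of \<open>S\<close> for \<open>k\<close>. With \<open>R\<^sub>n\<close> the class \<open>S\<close> for
  \<open>a\<^sub>n\<close>, \<open>P\<close> reduces to \<open>Q \<otimes> R\<^sub>n\<close> with \<open>n\<close> mind changes.

  If \<open>r\<close> were least, witnessed by \<open>U\<close>, then \<open>P\<close> would reduce to \<open>Q \<otimes> U\<close> by means of \<open>N\<close> functions that are
  continuous on their domains, and \<open>U\<close> to every \<open>R\<^sub>n\<close>. Take \<open>n = N\<close>. Column \<open>a\<^sub>n\<close> computes some \<open>h \<in> U\<close>,
  and independence forces the output on \<open>y \<oplus> h\<close> to name \<open>n\<close> and the true \<open>m\<close>. Raising \<open>m\<close> one by one,
  each time after the current function has committed itself, takes \<open>n + 1\<close> functions.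
\<close>

section \<open>Computable operators\<close>

class encodable =
  fixes enc :: "'a \<Rightarrow> nat"
  assumes bij_enc: "bij enc"
begin

definition unenc :: "nat \<Rightarrow> 'a" where
  "unenc = inv enc"

lemma unenc_enc [simp]: "unenc (enc x) = x"
  unfolding unenc_def by (rule inv_f_f[OF bij_is_inj[OF bij_enc]])

lemma enc_unenc [simp]: "enc (unenc n) = n"
  unfolding unenc_def by (rule surj_f_inv_f[OF bij_is_surj[OF bij_enc]])

lemma enc_eq_iff [simp]: "enc x = enc y \<longleftrightarrow> x = y"
  by (metis unenc_enc)

end

instantiation nat :: encodable
begin
definition enc_nat_def [simp]: "enc (n :: nat) = n"
instance by standard (simp add: bij_def inj_def surj_def)
end

instantiation prod :: (encodable, encodable) encodable
begin
definition "enc (z :: 'a \<times> 'b) = prod_encode (enc (fst z), enc (snd z))"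
instance
proof
  show "bij (enc :: 'a \<times> 'b \<Rightarrow> nat)"
    by (rule bij_betw_byWitness[where f' = "\<lambda>n. (unenc (fst (prod_decode n)), unenc (snd (prod_decode n)))"])
      (auto simp: enc_prod_def)
qed
end

instantiation list :: (encodable) encodable
begin
definition "enc (xs :: 'a list) = list_encode (map enc xs)"
instance
proof
  show "bij (enc :: 'a list \<Rightarrow> nat)"
    by (rule bij_betw_byWitness[where f' = "\<lambda>n. map unenc (list_decode n)"])
      (auto simp: enc_list_def comp_def)
qed
end

lemma enc_Pair [simp]: "enc (a, b) = prod_encode (enc a, enc b)"
  by (simp add: enc_prod_def)

lemma enc_Nil [simp]: "enc [] = 0"
  by (simp add: enc_list_def)

lemma enc_Cons [simp]: "enc (x # xs) = Suc (prod_encode (enc x, enc xs))"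
  by (simp add: enc_list_def)

lemma enc_nat_list: "enc (xs :: nat list) = list_encode xs"
proof -
  have "map enc xs = xs" by (induction xs) auto
  then show ?thesis by (simp add: enc_list_def)
qed

text \<open>One program serves all oracles in \<open>G\<close>. The set \<open>G\<close> is a
  promise, under which for example an unbounded search terminates; a singleton \<open>G\<close>
  gives computability from one oracle.\<close>

definition computable_on :: "baire set \<Rightarrow> (baire \<Rightarrow> 'e::encodable \<Rightarrow> 'a::encodable) \<Rightarrow> bool" where
  "computable_on G F \<longleftrightarrow> (\<exists>p. \<forall>g\<in>G. \<forall>x. run p g (enc x) = Some (enc (F g x)))"

definition decidable_on :: "baire set \<Rightarrow> (baire \<Rightarrow> 'e::encodable \<Rightarrow> bool) \<Rightarrow> bool" where
  "decidable_on G D \<longleftrightarrow> computable_on G (\<lambda>g x. of_bool (D g x) :: nat)"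

named_theorems comp_intros

section \<open>Closure properties of computable operators\<close>

lemma computable_onI:
  "(\<And>g x. g \<in> G \<Longrightarrow> run p g (enc x) = Some (enc (F g x))) \<Longrightarrow> computable_on G F"
  unfolding computable_on_def by blast

lemma computable_on_cong:
  assumes "computable_on G F" and "\<And>g x. g \<in> G \<Longrightarrow> F g x = F' g x"
  shows "computable_on G F'"
  using assms unfolding computable_on_def by simp

text \<open>\<open>Pairing Fst Snd\<close> takes a number apart and puts it together again, so it is
  an identity program. It also realises maps such as \<open>unenc\<close> and
  \<open>prod_decode\<close>, which leave the code unchanged.\<close>

lemma computable_on_id [comp_intros]: "computable_on G (\<lambda>g x. x)"
  by (rule computable_onI[of _ "Pairing Fst Snd"]) simp

primrec const_prog :: "nat \<Rightarrow> oprog" where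
  "const_prog 0 = Zero"
| "const_prog (Suc n) = Comp Succ (const_prog n)"

lemma run_const_prog [simp]: "run (const_prog n) g x = Some n"
  by (induction n) auto

lemma computable_on_const [comp_intros]: "computable_on G (\<lambda>g x. c)"
  by (rule computable_onI[of _ "const_prog (enc c)"]) simp

lemma computable_on_comp:
  assumes "computable_on G F" "computable_on G a"
  shows "computable_on G (\<lambda>g x. F g (a g x))"
proof -
  obtain p q where "\<forall>g\<in>G. \<forall>x. run p g (enc x) = Some (enc (F g x))"
    "\<forall>g\<in>G. \<forall>x. run q g (enc x) = Some (enc (a g x))"
    using assms unfolding computable_on_def by blast
  then show ?thesis by (intro computable_onI[of _ "Comp p q"]) simp
qed

lemma decidable_on_comp:
  "decidable_on G D \<Longrightarrow> computable_on G a \<Longrightarrow> decidable_on G (\<lambda>g x. D g (a g x))"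
  unfolding decidable_on_def by (rule computable_on_comp)

lemma computable_on_Pair [comp_intros]:
  assumes "computable_on G a" "computable_on G b"
  shows "computable_on G (\<lambda>g x. (a g x, b g x))"
proof -
  obtain p q where "\<forall>g\<in>G. \<forall>x. run p g (enc x) = Some (enc (a g x))"
    "\<forall>g\<in>G. \<forall>x. run q g (enc x) = Some (enc (b g x))"
    using assms unfolding computable_on_def by blast
  then show ?thesis by (intro computable_onI[of _ "Pairing p q"]) simp
qed

lemma computable_on_via_nat:
  assumes "computable_on G a" and "\<And>g y. g \<in> G \<Longrightarrow> run p g (enc y) = Some (enc (f g y))"
  shows "computable_on G (\<lambda>g x. f g (a g x))"
  by (rule computable_on_comp[OF computable_onI assms(1)]) (rule assms(2))

lemma computable_on_fst [comp_intros]: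
  "computable_on G a \<Longrightarrow> computable_on G (\<lambda>g x. fst (a g x))"
  by (erule computable_on_via_nat[where p = Fst]) (simp add: enc_prod_def)

lemma computable_on_snd [comp_intros]:
  "computable_on G a \<Longrightarrow> computable_on G (\<lambda>g x. snd (a g x))"
  by (erule computable_on_via_nat[where p = Snd]) (simp add: enc_prod_def)

lemma computable_on_oracle [comp_intros]:
  "computable_on G a \<Longrightarrow> computable_on G (\<lambda>g x. g (a g x))"
  by (erule computable_on_via_nat[where p = Oracle]) simp

lemma computable_on_Suc [comp_intros]:
  "computable_on G a \<Longrightarrow> computable_on G (\<lambda>g x. Suc (a g x))"
  by (erule computable_on_via_nat[where p = Succ]) simp

lemma computable_on_prod_decode [comp_intros]:
  "computable_on G a \<Longrightarrow> computable_on G (\<lambda>g x. prod_decode (a g x))"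
  by (erule computable_on_via_nat[where p = "Pairing Fst Snd"]) (simp add: enc_prod_def)

lemma computable_on_prod_encode [comp_intros]:
  "computable_on G a \<Longrightarrow> computable_on G (\<lambda>g x. prod_encode (a g x))"
  by (erule computable_on_via_nat[where p = "Pairing Fst Snd"]) (simp add: enc_prod_def)

lemma computable_on_enc [comp_intros]:
  "computable_on G a \<Longrightarrow> computable_on G (\<lambda>g x. enc (a g x))"
  by (erule computable_on_via_nat[where p = "Pairing Fst Snd"]) simp

lemma computable_on_unenc [comp_intros]:
  "computable_on G a \<Longrightarrow> computable_on G (\<lambda>g x. unenc (a g x))"
  by (erule computable_on_via_nat[where p = "Pairing Fst Snd"]) simp

lemma computable_on_rec_nat [comp_intros]:
  assumes "computable_on G a"
    and "computable_on G (\<lambda>g z. f g (fst z) (fst (snd z)) (snd (snd z)))"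
    and "computable_on G n"
  shows "computable_on G (\<lambda>g x. rec_nat (a g x) (f g x) (n g x))"
proof -
  obtain p q where p: "\<And>g x. g \<in> G \<Longrightarrow> run p g (enc x) = Some (enc (a g x))"
    and q: "\<And>g z. g \<in> G \<Longrightarrow>
      run q g (enc z) = Some (enc (f g (fst z) (fst (snd z)) (snd (snd z))))"
    using assms(1,2) unfolding computable_on_def by blast
  have q': "run q g (prod_encode (enc x, prod_encode (k, enc r))) = Some (enc (f g x k r))"
    if "g \<in> G" for g x k r
    using q[OF that, of "(x, k, r)"] by simp
  have "run (Prec p q) g (enc (x, m)) = Some (enc (rec_nat (a g x) (f g x) m))"
    if "g \<in> G" for g x m
    using that by (induction m) (simp_all add: p q')
  then have "computable_on G (\<lambda>g (z :: 'a \<times> nat). rec_nat (a g (fst z)) (f g (fst z)) (snd z))"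
    by (intro computable_onI[of _ "Prec p q"]) (metis prod.collapse)
  from computable_on_comp[OF this computable_on_Pair[OF computable_on_id assms(3)]]
  show ?thesis by simp
qed

lemma computable_on_plus [comp_intros]:
  assumes "computable_on G a" "computable_on G b"
  shows "computable_on G (\<lambda>g x. a g x + b g x :: nat)"
proof -
  have eq: "m + n = rec_nat m (\<lambda>k r. Suc r) n" for m n :: nat by (induction n) auto
  show ?thesis unfolding eq by (intro comp_intros assms)
qed

lemma computable_on_minus [comp_intros]:
  assumes "computable_on G a" "computable_on G b"
  shows "computable_on G (\<lambda>g x. a g x - b g x :: nat)"
proof -
  have pred: "rec_nat 0 (\<lambda>k _. k) r = r - 1" for r :: nat by (cases r) auto
  have eq: "m - n = rec_nat m (\<lambda>_ r. rec_nat 0 (\<lambda>k _. k) r) n" for m n :: nat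
    by (induction n) (auto simp: pred)
  show ?thesis unfolding eq by (intro comp_intros assms)
qed

lemma computable_on_times [comp_intros]:
  assumes "computable_on G a" "computable_on G b"
  shows "computable_on G (\<lambda>g x. a g x * b g x :: nat)"
proof -
  have eq: "m * n = rec_nat 0 (\<lambda>k r. r + m) n" for m n :: nat by (induction n) auto
  show ?thesis
    unfolding eq by (intro comp_intros assms computable_on_comp[OF assms(1)])
qed

lemma computable_on_if [comp_intros]:
  assumes "decidable_on G D" "computable_on G a" "computable_on G b"
  shows "computable_on G (\<lambda>g x. if D g x then a g x else b g x)"
proof -
  have eq: "(if d then r else s) = rec_nat s (\<lambda>_ _. r) (of_bool d)" for d and r s :: 'b
    by simp
  show ?thesis
    unfolding eq by (intro comp_intros assms[unfolded decidable_on_def]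
        computable_on_comp[OF assms(2)])
qed

lemma decidable_on_const [comp_intros]: "decidable_on G (\<lambda>g x. c)"
  unfolding decidable_on_def by (intro comp_intros)

lemma decidable_on_not [comp_intros]:
  assumes "decidable_on G D"
  shows "decidable_on G (\<lambda>g x. \<not> D g x)"
proof -
  have eq: "of_bool (\<not> d) = (if d then 0 else 1 :: nat)" for d by simp
  show ?thesis unfolding decidable_on_def eq by (intro comp_intros assms)
qed

lemma decidable_on_conj [comp_intros]:
  assumes "decidable_on G D" "decidable_on G E"
  shows "decidable_on G (\<lambda>g x. D g x \<and> E g x)"
proof -
  have eq: "of_bool (d \<and> e) = (if d then of_bool e else 0 :: nat)" for d e by simp
  show ?thesis
    unfolding decidable_on_def eq by (intro comp_intros assms assms(2)[unfolded decidable_on_def])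
qed

lemma decidable_on_disj [comp_intros]:
  assumes "decidable_on G D" "decidable_on G E"
  shows "decidable_on G (\<lambda>g x. D g x \<or> E g x)"
proof -
  have eq: "(d \<or> e) \<longleftrightarrow> \<not> (\<not> d \<and> \<not> e)" for d e by blast
  show ?thesis unfolding eq by (intro comp_intros assms)
qed

lemma decidable_on_imp [comp_intros]:
  assumes "decidable_on G D" "decidable_on G E"
  shows "decidable_on G (\<lambda>g x. D g x \<longrightarrow> E g x)"
proof -
  have eq: "(d \<longrightarrow> e) \<longleftrightarrow> \<not> d \<or> e" for d e by blast
  show ?thesis unfolding eq by (intro comp_intros assms)
qed

lemma decidable_on_zero:
  assumes "computable_on G (a :: baire \<Rightarrow> 'e::encodable \<Rightarrow> nat)"
  shows "decidable_on G (\<lambda>g x. a g x = 0)"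
proof -
  have eq: "of_bool (m = 0) = (1 - m :: nat)" for m :: nat by (cases m) auto
  show ?thesis unfolding decidable_on_def eq by (intro comp_intros assms)
qed

lemma decidable_on_le [comp_intros]:
  assumes "computable_on G a" "computable_on G b"
  shows "decidable_on G (\<lambda>g x. (a g x :: nat) \<le> b g x)"
proof -
  have eq: "m \<le> n \<longleftrightarrow> m - n = 0" for m n :: nat by simp
  show ?thesis unfolding eq by (intro decidable_on_zero comp_intros assms)
qed

lemma decidable_on_less [comp_intros]:
  assumes "computable_on G a" "computable_on G b"
  shows "decidable_on G (\<lambda>g x. (a g x :: nat) < b g x)"
  unfolding less_eq_Suc_le by (intro comp_intros assms)

lemma decidable_on_eq [comp_intros]:
  assumes "computable_on G a" "computable_on G b"
  shows "decidable_on G (\<lambda>g x. a g x = b g x)"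
proof -
  have eq: "y = z \<longleftrightarrow> enc y \<le> enc z \<and> enc z \<le> enc y" for y z :: 'b by (auto simp: order.eq_iff[symmetric])
  show ?thesis unfolding eq by (intro comp_intros assms)
qed

lemma computable_on_Least:
  fixes D :: "baire \<Rightarrow> 'e::encodable \<Rightarrow> nat \<Rightarrow> bool"
  assumes "decidable_on G (\<lambda>g z. D g (fst z) (snd z))"
    and "\<And>g x. g \<in> G \<Longrightarrow> \<exists>k. D g x k"
  shows "computable_on G (\<lambda>g x. LEAST k. D g x k)"
proof -
  \<comment> \<open>\<open>Mu\<close> looks for the value 0, hence the indicator of the
    negation.\<close>
  have "decidable_on G (\<lambda>g z. \<not> D g (fst z) (snd z))"
    by (intro comp_intros assms)
  then obtain p where "\<forall>g\<in>G. \<forall>z. run p g (enc z) = Some (of_bool (\<not> D g (fst z) (snd z)))"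
    unfolding decidable_on_def computable_on_def by auto
  then have p: "run p g (prod_encode (enc x, k)) = Some (of_bool (\<not> D g x k))" if "g \<in> G" for g x k
    using that by (metis enc_Pair enc_nat_def fst_conv snd_conv)
  have "run (Mu p) g (enc x) = Some (LEAST k. D g x k)" if "g \<in> G" for g x
    using assms(2)[OF that, of x] by (simp add: Let_def p[OF that])
  then show ?thesis by (intro computable_onI[of _ "Mu p"]) simp
qed

lemma decidable_on_bounded_all [comp_intros]:
  fixes D :: "baire \<Rightarrow> 'e::encodable \<Rightarrow> nat \<Rightarrow> bool"
  assumes "computable_on G n" "decidable_on G (\<lambda>g z. D g (fst z) (snd z))"
  shows "decidable_on G (\<lambda>g x. \<forall>k < n g x. D g x k)"
proof -
  \<comment> \<open>The disjunct \<open>k = m\<close> ends the search at the bound if no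
    counterexample comes first.\<close>
  have eq: "(\<forall>k<m. P k) \<longleftrightarrow> (LEAST k. k = m \<or> \<not> P k) = m" for m :: nat and P
  proof
    assume "\<forall>k<m. P k"
    then show "(LEAST k. k = m \<or> \<not> P k) = m"
      by (intro Least_equality) (auto simp: not_less[symmetric])
  next
    assume "(LEAST k. k = m \<or> \<not> P k) = m"
    then show "\<forall>k<m. P k" using not_less_Least by metis
  qed
  show ?thesis unfolding eq
    by (intro decidable_on_eq computable_on_Least decidable_on_disj decidable_on_not assms
        computable_on_snd computable_on_id computable_on_comp[OF assms(1)] computable_on_fst) auto
qed

lemma computable_on_div [comp_intros]:
  assumes "computable_on G a" "computable_on G b"
  shows "computable_on G (\<lambda>g x. a g x div b g x :: nat)"
proof -
  \<comment> \<open>The disjunct \<open>n = 0\<close> stops the search at 0, in accordance with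
    \<open>m div 0 = 0\<close>.\<close>
  have eq: "m div n = (LEAST k. n = 0 \<or> m < Suc k * n)" for m n :: nat
  proof (cases "n = 0")
    case False
    show ?thesis
    proof (rule Least_equality[symmetric])
      show "n = 0 \<or> m < Suc (m div n) * n"
        using False by (metis dividend_less_div_times add.commute mult_Suc not_gr_zero)
      show "m div n \<le> k" if "n = 0 \<or> m < Suc k * n" for k
        using that False by (metis div_less_iff_less_mult less_Suc_eq_le not_gr_zero)
    qed
  qed (simp add: Least_eq_0)
  have ex: "\<exists>k. n = 0 \<or> m < Suc k * n" for m n :: nat
    by (metis lessI less_le_trans mult_le_mono1 mult.right_neutral mult_Suc_right le_add1 not_gr_zero
        Suc_leI mult.commute)
  show ?thesis unfolding eq
    by (intro computable_on_Least comp_intros ex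
        computable_on_comp[OF assms(1)] computable_on_comp[OF assms(2)])
qed

lemma computable_on_mod [comp_intros]:
  assumes "computable_on G a" "computable_on G b"
  shows "computable_on G (\<lambda>g x. a g x mod b g x :: nat)"
  unfolding modulo_nat_def by (intro comp_intros assms)

lemma computable_on_funpow [comp_intros]:
  fixes f :: "baire \<Rightarrow> 'e::encodable \<Rightarrow> 'b::encodable \<Rightarrow> 'b"
  assumes "computable_on G (\<lambda>g z. f g (fst z) (snd z))" "computable_on G n" "computable_on G a"
  shows "computable_on G (\<lambda>g x. (f g x ^^ n g x) (a g x))"
proof -
  have eq: "(h ^^ m) y = rec_nat y (\<lambda>_ r. h r) m" for h :: "'b \<Rightarrow> 'b" and m y
    by (induction m) auto
  have f: "computable_on G (\<lambda>g z. f g (fst z) (snd (snd z)))"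
    using computable_on_comp[OF assms(1), of "\<lambda>g z. (fst z, snd (snd z))"]
    unfolding fst_conv snd_conv by this (intro comp_intros)
  show ?thesis unfolding eq by (intro comp_intros assms f)
qed

lemma computable_on_Cons [comp_intros]:
  assumes "computable_on G a" "computable_on G b"
  shows "computable_on G (\<lambda>g x. a g x # b g x)"
proof -
  have eq: "y # ys = unenc (Suc (prod_encode (enc y, enc ys)))" for y :: 'b and ys
    by (metis enc_Cons unenc_enc)
  show ?thesis unfolding eq by (intro comp_intros assms)
qed

lemma computable_on_tl [comp_intros]:
  assumes "computable_on G a"
  shows "computable_on G (\<lambda>g x. tl (a g x))"
proof -
  \<comment> \<open>The empty list has code 0, and \<open>0 - 1 = 0\<close> decodes to a pair of
    zeros, so the formula below also gives \<open>tl [] = []\<close>.\<close>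
  have "prod_decode 0 = (0, 0)"
    using prod_encode_inverse[of "(0, 0)"] by (simp add: prod_encode_def)
  then have "enc (tl xs) = snd (prod_decode (enc xs - 1))" for xs :: "'b list"
    by (cases xs) simp_all
  then have eq: "tl xs = unenc (snd (prod_decode (enc xs - 1)))" for xs :: "'b list"
    by (metis unenc_enc)
  show ?thesis unfolding eq by (intro comp_intros assms)
qed

lemma computable_on_hd [comp_intros]:
  assumes "computable_on G a"
  shows "computable_on G (\<lambda>g x. hd (a g x))"
proof -
  have eq: "hd xs = (if xs = [] then hd [] else unenc (fst (prod_decode (enc xs - 1))))"
    for xs :: "'b list"
    by (cases xs) auto
  show ?thesis by (subst eq) (intro comp_intros assms)
qed

lemma computable_on_drop [comp_intros]:
  assumes "computable_on G n" "computable_on G a"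
  shows "computable_on G (\<lambda>g x. drop (n g x) (a g x))"
proof -
  have eq: "drop m xs = (tl ^^ m) xs" for m and xs :: "'b list"
    by (induction m arbitrary: xs) (simp_all add: drop_Suc funpow_Suc_right del: funpow.simps(2))
  show ?thesis unfolding eq by (intro comp_intros assms)
qed

lemma computable_on_length [comp_intros]:
  assumes "computable_on G a"
  shows "computable_on G (\<lambda>g x. length (a g x))"
proof -
  have eq: "length xs = (LEAST k. drop k xs = [])" for xs :: "'b list"
    by (rule Least_equality[symmetric]) auto
  have ex: "\<exists>k. drop k xs = []" for xs :: "'b list" by (metis drop_all order_refl)
  show ?thesis unfolding eq
    by (intro computable_on_Least comp_intros ex computable_on_comp[OF assms(1)])
qed

lemma decidable_on_ball [comp_intros]:
  assumes "computable_on G a" "decidable_on G (\<lambda>g z. D g (fst z) (snd z))"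
  shows "decidable_on G (\<lambda>g x. \<forall>y\<in>set (a g x). D g x y)"
proof -
  have eq: "(\<forall>y\<in>set xs. P y) \<longleftrightarrow> (\<forall>k<length xs. P (hd (drop k xs)))" for xs :: "'b list" and P
    by (auto simp: all_set_conv_all_nth hd_drop_conv_nth)
  have D: "decidable_on G (\<lambda>g z. D g (fst z) (hd (drop (snd z) (a g (fst z)))))"
    using decidable_on_comp[OF assms(2), of "\<lambda>g z. (fst z, hd (drop (snd z) (a g (fst z))))"]
    unfolding fst_conv snd_conv by this (intro comp_intros computable_on_comp[OF assms(1)])
  show ?thesis unfolding eq by (intro comp_intros assms(1) D)
qed

lemma decidable_on_bex [comp_intros]:
  assumes "computable_on G a" "decidable_on G (\<lambda>g z. D g (fst z) (snd z))"
  shows "decidable_on G (\<lambda>g x. \<exists>y\<in>set (a g x). D g x y)"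
proof -
  have eq: "(\<exists>y\<in>Y. P y) \<longleftrightarrow> \<not> (\<forall>y\<in>Y. \<not> P y)" for Y :: "'b set" and P by blast
  show ?thesis unfolding eq by (intro comp_intros assms)
qed

lemma decidable_on_member [comp_intros]:
  assumes "computable_on G a" "computable_on G b"
  shows "decidable_on G (\<lambda>g x. a g x \<in> set (b g x))"
proof -
  have eq: "y \<in> Y \<longleftrightarrow> (\<exists>z\<in>Y. z = y)" for y :: 'b and Y by blast
  show ?thesis unfolding eq by (intro comp_intros assms computable_on_comp[OF assms(1)])
qed

section \<open>Oracle substitution and Turing reducibility\<close>

primrec subst :: "oprog \<Rightarrow> oprog \<Rightarrow> oprog" where
  "subst q Zero = Zero"
| "subst q Succ = Succ"
| "subst q Fst = Fst"
| "subst q Snd = Snd"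
| "subst q Oracle = q"
| "subst q (Pairing r s) = Pairing (subst q r) (subst q s)"
| "subst q (Comp r s) = Comp (subst q r) (subst q s)"
| "subst q (Prec r s) = Prec (subst q r) (subst q s)"
| "subst q (Mu r) = Mu (subst q r)"

lemma run_subst:
  assumes "\<And>x. run q g x = Some (h x)"
  shows "run (subst q p) g = run p h"
  by (induction p) (auto simp: assms)

lemma computable_on_subst:
  assumes "computable_on G' F" and "computable_on G H" and "\<And>g. g \<in> G \<Longrightarrow> H g \<in> G'"
  shows "computable_on G (\<lambda>g x. F (H g) x)"
proof -
  obtain p q where p: "\<forall>g\<in>G'. \<forall>x. run p g (enc x) = Some (enc (F g x))"
    and q: "\<forall>g\<in>G. \<forall>n. run q g n = Some (H g n)"
    using assms(1,2) unfolding computable_on_def by auto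
  have "run (subst q p) g = run p (H g)" if "g \<in> G" for g
    by (rule run_subst) (use q that in blast)
  with p assms(3) show ?thesis by (intro computable_onI[of _ "subst q p"]) simp
qed

lemma decidable_on_subst:
  assumes "decidable_on UNIV D" and "computable_on G H"
  shows "decidable_on G (\<lambda>g x. D (H g) x)"
  using assms unfolding decidable_on_def by (rule computable_on_subst) simp

text \<open>A finite table of an arbitrary \<open>f\<close> is wired into the program, one entry per
  induction step. This makes Turing reducibility insensitive to finite changes and supplies learners
  with finite lists of indices.\<close>

lemma computable_on_finite_exceptions:
  assumes "finite A" and "computable_on G F"
  shows "computable_on G (\<lambda>g x. if x \<in> A then f x else F g x)"
  using assms(1)
proof induction
  case (insert a A)
  have eq: "(if x \<in> insert a A then f x else F g x) =
      (if x = a then f a else if x \<in> A then f x else F g x)" for g x by auto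
  show ?case unfolding eq by (intro comp_intros insert.IH)
qed (use assms(2) in simp)

definition turing_le :: "baire \<Rightarrow> baire \<Rightarrow> bool" where
  "turing_le h g \<longleftrightarrow> computable_on {g} (\<lambda>_. h)"

lemma turing_le_iff_run: "turing_le h g \<longleftrightarrow> (\<exists>p. \<forall>x. run p g x = Some (h x))"
  by (simp add: turing_le_def computable_on_def)

lemma turing_le_trans: "turing_le f h \<Longrightarrow> turing_le h g \<Longrightarrow> turing_le f g"
  unfolding turing_le_def by (rule computable_on_subst) auto

lemma turing_leI:
  assumes "computable_on {g} F" and "F g = h"
  shows "turing_le h g"
  unfolding turing_le_def by (rule computable_on_cong[OF assms(1)]) (use assms(2) in auto)

lemma turing_le_finite_difference:
  assumes "finite {n. f n \<noteq> h n}" and "turing_le h g"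
  shows "turing_le f g"
  unfolding turing_le_def
  by (rule computable_on_cong[OF computable_on_finite_exceptions[OF assms(1)
          assms(2)[unfolded turing_le_def], of f]]) auto

section \<open>Derivations as certificates of computations\<close>

text \<open>The index is shifted: \<open>Suc i\<close> blanks out column \<open>i\<close>, and \<open>0\<close> leaves the oracle unchanged.\<close>

definition omit_column :: "nat \<Rightarrow> baire \<Rightarrow> baire" where
  "omit_column i g = (\<lambda>n. if Suc (fst (prod_decode n)) = i then 0 else g n)"

lemma omit_column_0 [simp]: "omit_column 0 g = g"
  by (simp add: omit_column_def)

text \<open>
  A triple \<open>(e, x, y)\<close> stands for the claim \<open>run (prog e) g x = Some y\<close>, with \<open>g\<close> known only on the
  string \<open>\<sigma>\<close>; it may refer to the claims in \<open>d\<close>. The arithmetic decodes the Goedel numbering \<^const>\<open>code\<close>.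
\<close>

definition justified :: "nat \<Rightarrow> nat list \<Rightarrow> (nat \<times> nat \<times> nat) list \<Rightarrow> nat \<times> nat \<times> nat \<Rightarrow> bool" where
  "justified i \<sigma> d z = (let e = fst z; x = fst (snd z); y = snd (snd z); m = (e - 5) div 4;
      a = fst (prod_decode m); b = snd (prod_decode m);
      u = fst (prod_decode x); k = snd (prod_decode x) in
    e = 0 \<and> y = 0 \<or> e = 1 \<and> y = Suc x \<or> e = 2 \<and> y = u \<or> e = 3 \<and> y = k \<or>
    e = 4 \<and> x < length \<sigma> \<and> y = (if Suc u = i then 0 else hd (drop x \<sigma>)) \<or>
    5 \<le> e \<and> (
      (e - 5) mod 4 = 0 \<and> (a, x, fst (prod_decode y)) \<in> set d \<and> (b, x, snd (prod_decode y)) \<in> set d \<or>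
      (e - 5) mod 4 = 1 \<and> (\<exists>w\<in>set d. w = (b, x, snd (snd w)) \<and> (a, snd (snd w), y) \<in> set d) \<or>
      (e - 5) mod 4 = 2 \<and> k = 0 \<and> (a, u, y) \<in> set d \<or>
      (e - 5) mod 4 = 2 \<and> k \<noteq> 0 \<and> (\<exists>w\<in>set d. w = (e, prod_encode (u, k - 1), snd (snd w)) \<and>
        (b, prod_encode (u, prod_encode (k - 1, snd (snd w))), y) \<in> set d) \<or>
      (e - 5) mod 4 = 3 \<and> (m, prod_encode (x, y), 0) \<in> set d \<and>
        (\<forall>j<y. \<exists>w\<in>set d. w = (m, prod_encode (x, j), snd (snd w)) \<and> snd (snd w) \<noteq> 0)))"

text \<open>A derivation grows at its head: each claim rests on the claims behind it in the
  list.\<close>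

primrec valid :: "nat \<Rightarrow> nat list \<Rightarrow> (nat \<times> nat \<times> nat) list \<Rightarrow> bool" where
  "valid i \<sigma> [] = True"
| "valid i \<sigma> (z # d) = (justified i \<sigma> d z \<and> valid i \<sigma> d)"

lemma valid_iff_nth: "valid i \<sigma> d \<longleftrightarrow> (\<forall>j<length d. justified i \<sigma> (drop (Suc j) d) (hd (drop j d)))"
proof (induction d)
  case (Cons z d)
  show ?case unfolding valid.simps Cons.IH length_Cons
    by (subst All_less_Suc2) auto
qed simp

lemma decidable_on_valid [comp_intros]:
  assumes "computable_on G i" "computable_on G \<sigma>" "computable_on G d"
  shows "decidable_on G (\<lambda>g x. valid (i g x) (\<sigma> g x) (d g x))"
proof -
  have 1: "decidable_on G (\<lambda>g z. justified (fst z) (fst (snd z)) (fst (snd (snd z))) (snd (snd (snd z))))"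
    unfolding justified_def Let_def by (intro comp_intros)
  have 2: "decidable_on G (\<lambda>g x. justified (i g x) (\<sigma> g x) (d g x) (z g x))"
    if "computable_on G i" "computable_on G \<sigma>" "computable_on G d" "computable_on G z"
    for i \<sigma> d and z :: "baire \<Rightarrow> 'z::encodable \<Rightarrow> nat \<times> nat \<times> nat"
    using decidable_on_comp[OF 1, of "\<lambda>g x. (i g x, \<sigma> g x, d g x, z g x)"]
    unfolding fst_conv snd_conv by this (intro comp_intros that)
  show ?thesis unfolding valid_iff_nth
    by (intro comp_intros 2 assms computable_on_comp[OF assms(1)] computable_on_comp[OF assms(2)]
        computable_on_comp[OF assms(3)])
qed

lemma justified_mono:
  assumes "justified i \<sigma> d z" "prefix \<sigma> \<sigma>'" "set d \<subseteq> set d'"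
  shows "justified i \<sigma>' d' z"
proof -
  have "n < length \<sigma>' \<and> hd (drop n \<sigma>') = hd (drop n \<sigma>)" if "n < length \<sigma>" for n
    using that assms(2) by (auto simp: prefix_def hd_drop_conv_nth nth_append)
  with assms(1,3) show ?thesis unfolding justified_def Let_def by (smt (verit) subset_iff)
qed

lemma valid_mono: "valid i \<sigma> d \<Longrightarrow> prefix \<sigma> \<sigma>' \<Longrightarrow> valid i \<sigma>' d"
  by (induction d) (auto intro: justified_mono)

lemma valid_append: "valid i \<sigma> d \<Longrightarrow> valid i \<sigma> d' \<Longrightarrow> valid i \<sigma> (d @ d')"
  by (induction d) (auto intro: justified_mono)

lemma run_Prec_Suc:
  "run (Prec p q) g (prod_encode (a, Suc n)) =
    Option.bind (run (Prec p q) g (prod_encode (a, n)))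
      (\<lambda>v. run q g (prod_encode (a, prod_encode (n, v))))"
  by simp

text \<open>A derivation can record only finitely many values, so the least hit is rephrased by the
  values up to it.\<close>

lemma run_Mu_eq_Some:
  "run (Mu p) g x = Some n \<longleftrightarrow> run p g (prod_encode (x, n)) = Some 0 \<and>
    (\<forall>m<n. \<exists>v. run p g (prod_encode (x, m)) = Some v \<and> v \<noteq> 0)"
  (is "_ \<longleftrightarrow> ?R n")
proof -
  define hit where "hit = (\<lambda>n. run p g (prod_encode (x, n)) = Some 0 \<and>
    (\<forall>m<n. run p g (prod_encode (x, m)) \<noteq> None))"
  have run: "run (Mu p) g x = (if \<exists>n. hit n then Some (LEAST n. hit n) else None)"
    by (simp add: hit_def Let_def)
  show ?thesis
  proof
    assume "run (Mu p) g x = Some n"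
    then have n: "n = (LEAST n. hit n)" and "\<exists>n. hit n"
      by (auto simp add: run simp del: run.simps split: if_splits)
    then have hit: "hit n" using LeastI_ex by metis
    have "\<exists>v. run p g (prod_encode (x, m)) = Some v \<and> v \<noteq> 0" if "m < n" for m
    proof -
      have "\<not> hit m" using not_less_Least that n by metis
      moreover have "\<And>k. k < m \<Longrightarrow> run p g (prod_encode (x, k)) \<noteq> None"
        "run p g (prod_encode (x, m)) \<noteq> None"
        using hit that unfolding hit_def by (meson less_trans)+
      ultimately show ?thesis unfolding hit_def by auto
    qed
    with hit show "?R n" unfolding hit_def by blast
  next
    assume R: "?R n"
    then have "hit n" unfolding hit_def by force
    moreover have "(LEAST n. hit n) = n"
    proof (rule Least_equality)
      show "n \<le> m" if "hit m" for m
        using that R unfolding hit_def by (metis not_le option.inject)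
    qed fact
    ultimately show "run (Mu p) g x = Some n" by (auto simp add: run simp del: run.simps)
  qed
qed

lemma mult_4_digits [simp]:
  "Suc (4 * m) div 4 = m" "Suc (Suc (4 * m)) div 4 = m" "Suc (Suc (Suc (4 * m))) div 4 = m"
  "Suc (4 * m) mod 4 = 1" "Suc (Suc (4 * m)) mod 4 = 2" "Suc (Suc (Suc (4 * m))) mod 4 = 3"
  by presburger+

text \<open>Each clause of \<open>justified\<close> mirrors one equation of \<open>run\<close>. Any
  oracle extending \<open>\<sigma>\<close> is allowed, which later yields the use principle.\<close>

lemma valid_sound:
  assumes "valid i \<sigma> d" and "\<And>n. n < length \<sigma> \<Longrightarrow> \<sigma> ! n = g n"
  shows "\<forall>(e, x, y)\<in>set d. run (prog e) (omit_column i g) x = Some y"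
  using assms(1)
proof (induction d)
  case (Cons z d)
  obtain e x y where z: "z = (e, x, y)" by (cases z)
  from Cons have IH: "\<And>e x y. (e, x, y) \<in> set d \<Longrightarrow> run (prog e) (omit_column i g) x = Some y"
    and j: "justified i \<sigma> d (e, x, y)" by (auto simp: z)
  have "run (prog e) (omit_column i g) x = Some y"
  proof (cases "prog e")
    case Oracle
    then have "e = 4" using code_prog[of e] by simp
    with j have "x < length \<sigma>" "y = (if Suc (fst (prod_decode x)) = i then 0 else hd (drop x \<sigma>))"
      by (auto simp: justified_def)
    then show ?thesis using assms(2) Oracle by (simp add: omit_column_def hd_drop_conv_nth)
  next
    case (Pairing p q)
    then have e: "e = 5 + 4 * prod_encode (code p, code q)" using code_prog[of e] by simp
    from j have "(code p, x, fst (prod_decode y)) \<in> set d" "(code q, x, snd (prod_decode y)) \<in> set d"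
      by (auto simp: justified_def Let_def e)
    then have "run p (omit_column i g) x = Some (fst (prod_decode y))"
      "run q (omit_column i g) x = Some (snd (prod_decode y))"
      using IH by fastforce+
    then show ?thesis using Pairing by simp
  next
    case (Comp p q)
    then have e: "e = 6 + 4 * prod_encode (code p, code q)" using code_prog[of e] by simp
    from j obtain v where "(code q, x, v) \<in> set d" "(code p, v, y) \<in> set d"
      by (auto simp: justified_def Let_def e)
    then show ?thesis using IH[of "code q"] IH[of "code p"] Comp by simp
  next
    case (Prec p q)
    then have e: "e = 7 + 4 * prod_encode (code p, code q)" using code_prog[of e] by simp
    obtain u k where x: "x = prod_encode (u, k)" by (metis prod_decode_inverse surj_pair)
    show ?thesis
    proof (cases k)
      case 0
      with j have "(code p, u, y) \<in> set d" by (auto simp: justified_def Let_def e x)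
      then show ?thesis using IH[of "code p"] Prec x 0 by simp
    next
      case (Suc n)
      with j obtain v where 1: "(e, prod_encode (u, n), v) \<in> set d"
        and 2: "(code q, prod_encode (u, prod_encode (n, v)), y) \<in> set d"
        by (auto simp: justified_def Let_def e x)
      show ?thesis unfolding x Suc Prec run_Prec_Suc IH[OF 1, unfolded Prec]
        using IH[OF 2] by simp
    qed
  next
    case (Mu p)
    then have e: "e = 8 + 4 * code p" using code_prog[of e] by simp
    from j have 0: "(code p, prod_encode (x, y), 0) \<in> set d"
      and 1: "\<And>j. j < y \<Longrightarrow> \<exists>w\<in>set d. w = (code p, prod_encode (x, j), snd (snd w)) \<and> snd (snd w) \<noteq> 0"
      by (auto simp: justified_def Let_def e)
    show ?thesis unfolding Mu run_Mu_eq_Some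
      using IH[OF 0] 1 IH[of "code p"] by (metis prog_code)
  qed (use j code_prog[of e] in \<open>auto simp: justified_def\<close>)
  with IH show ?case by (auto simp: z)
qed simp

section \<open>Completeness of derivations\<close>

definition derivable :: "nat \<Rightarrow> baire \<Rightarrow> nat \<times> nat \<times> nat \<Rightarrow> bool" where
  "derivable i g z \<longleftrightarrow> (\<exists>d n. valid i (g \<restriction> n) d \<and> z \<in> set d)"

lemma length_initial [simp]: "length (g \<restriction> n) = n"
  by (simp add: initial_def)

lemma nth_initial [simp]: "m < n \<Longrightarrow> (g \<restriction> n) ! m = g m"
  by (simp add: initial_def)

lemma prefix_initial: "m \<le> n \<Longrightarrow> prefix (g \<restriction> m) (g \<restriction> n)"
  unfolding initial_def by (metis le_add_diff_inverse map_append prefix_def upt_add_eq_append zero_le)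

text \<open>Derivations are concatenated and the longest initial segment is taken; \<open>m\<close>
  reserves room for an oracle query made by the claim to be added next.\<close>

lemma derivable_set:
  assumes "finite A" "\<And>z. z \<in> A \<Longrightarrow> derivable i g z"
  shows "\<exists>d n. m \<le> n \<and> valid i (g \<restriction> n) d \<and> A \<subseteq> set d"
  using assms
proof induction
  case empty
  show ?case by (rule exI[of _ "[]"]) auto
next
  case (insert z A)
  from insert obtain d n where 1: "m \<le> n" "valid i (g \<restriction> n) d" "A \<subseteq> set d" by auto
  have "derivable i g z" using insert.prems by simp
  then obtain d' n' where 2: "valid i (g \<restriction> n') d'" "z \<in> set d'"
    unfolding derivable_def by blast
  have "valid i (g \<restriction> max n n') (d @ d')"
    using 1 2 by (intro valid_append) (auto elim!: valid_mono intro: prefix_initial)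
  with 1 2 show ?case by (intro exI[of _ "d @ d'"] exI[of _ "max n n'"]) auto
qed

lemma derivableI:
  assumes "finite A" "\<And>z. z \<in> A \<Longrightarrow> derivable i g z"
    and "\<And>d n. m \<le> n \<Longrightarrow> A \<subseteq> set d \<Longrightarrow> justified i (g \<restriction> n) d z"
  shows "derivable i g z"
proof -
  obtain d n where "m \<le> n" "valid i (g \<restriction> n) d" "A \<subseteq> set d"
    using derivable_set[OF assms(1,2)] by blast
  then have "valid i (g \<restriction> n) (z # d)" using assms(3) by simp
  then show ?thesis unfolding derivable_def by (meson list.set_intros(1))
qed

lemma justified_code:
  "justified i \<sigma> d (code (Pairing p q), x, prod_encode (u, v)) \<longleftrightarrow>
    (code p, x, u) \<in> set d \<and> (code q, x, v) \<in> set d"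
  "justified i \<sigma> d (code (Comp p q), x, y) \<longleftrightarrow>
    (\<exists>v. (code q, x, v) \<in> set d \<and> (code p, v, y) \<in> set d)"
  "justified i \<sigma> d (code (Prec p q), prod_encode (a, 0), y) \<longleftrightarrow> (code p, a, y) \<in> set d"
  "justified i \<sigma> d (code (Prec p q), prod_encode (a, Suc n), y) \<longleftrightarrow>
    (\<exists>v. (code (Prec p q), prod_encode (a, n), v) \<in> set d \<and>
      (code q, prod_encode (a, prod_encode (n, v)), y) \<in> set d)"
  "justified i \<sigma> d (code (Mu p), x, y) \<longleftrightarrow> (code p, prod_encode (x, y), 0) \<in> set d \<and>
    (\<forall>j<y. \<exists>v. (code p, prod_encode (x, j), v) \<in> set d \<and> v \<noteq> 0)"
  by (simp_all add: justified_def Let_def Bex_def split_paired_Ex)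

text \<open>Structural induction on the program, with an inner induction on the recursion counter
  for \<open>Prec\<close>. A search with result \<open>y\<close> combines the derivations of its
  \<open>y + 1\<close> trial values.\<close>

lemma run_derivable: "run p (omit_column i g) x = Some y \<Longrightarrow> derivable i g (code p, x, y)"
proof -
  have axiom: "derivable i g z" if "\<And>d n. justified i (g \<restriction> n) d z" for z
    using derivableI[of "{}" i g 0 z] that by simp
  show "run p (omit_column i g) x = Some y \<Longrightarrow> derivable i g (code p, x, y)"
  proof (induction p arbitrary: x y)
    case Oracle
    then have y: "y = omit_column i g x" by simp
    show ?case unfolding y
      by (rule derivableI[where A = "{}" and m = "Suc x"]) (auto simp: justified_def omit_column_def hd_drop_conv_nth)
  next
    case (Pairing p q)
    then obtain u v where "run p (omit_column i g) x = Some u" "run q (omit_column i g) x = Some v"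
      and y: "y = prod_encode (u, v)" by (auto simp: bind_eq_Some_conv)
    then have der: "derivable i g (code p, x, u)" "derivable i g (code q, x, v)"
      using Pairing.IH by blast+
    show ?case unfolding y
      by (rule derivableI[where A = "{(code p, x, u), (code q, x, v)}" and m = 0]) (use der in \<open>auto simp: justified_code simp del: code.simps\<close>)
  next
    case (Comp p q)
    then obtain v where "run q (omit_column i g) x = Some v" "run p (omit_column i g) v = Some y"
      by (auto simp: bind_eq_Some_conv)
    then have der: "derivable i g (code q, x, v)" "derivable i g (code p, v, y)"
      using Comp.IH by blast+
    show ?case
      by (rule derivableI[where A = "{(code q, x, v), (code p, v, y)}" and m = 0]) (use der in \<open>auto simp: justified_code simp del: code.simps\<close>)
  next
    case (Prec p q)
    obtain u k where x: "x = prod_encode (u, k)" by (metis prod_decode_inverse surj_pair)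
    have "run (Prec p q) (omit_column i g) (prod_encode (u, k)) = Some y \<Longrightarrow>
        derivable i g (code (Prec p q), prod_encode (u, k), y)" for y
    proof (induction k arbitrary: y)
      case 0
      then have der: "derivable i g (code p, u, y)" using Prec.IH(1) by simp
      show ?case
        by (rule derivableI[where A = "{(code p, u, y)}" and m = 0]) (use der in \<open>auto simp: justified_code simp del: code.simps\<close>)
    next
      case (Suc n)
      then obtain v where "run (Prec p q) (omit_column i g) (prod_encode (u, n)) = Some v"
        and v: "run q (omit_column i g) (prod_encode (u, prod_encode (n, v))) = Some y"
        unfolding run_Prec_Suc bind_eq_Some_conv by blast
      then have der: "derivable i g (code (Prec p q), prod_encode (u, n), v)"
        "derivable i g (code q, prod_encode (u, prod_encode (n, v)), y)"
        using Suc.IH Prec.IH(2) by blast+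
      show ?case
        by (rule derivableI[where A = "{(code (Prec p q), prod_encode (u, n), v),
            (code q, prod_encode (u, prod_encode (n, v)), y)}" and m = 0]) (use der in \<open>auto simp: justified_code simp del: code.simps\<close>)
    qed
    with Prec.prems show ?case unfolding x by blast
  next
    case (Mu p)
    have y: "run p (omit_column i g) (prod_encode (x, y)) = Some 0"
      and "\<forall>m<y. \<exists>v. run p (omit_column i g) (prod_encode (x, m)) = Some v \<and> v \<noteq> 0"
      using Mu.prems[unfolded run_Mu_eq_Some] by blast+
    then obtain v where v: "\<And>m. m < y \<Longrightarrow> run p (omit_column i g) (prod_encode (x, m)) = Some (v m) \<and> v m \<noteq> 0"
      by metis
    define A where "A = insert (code p, prod_encode (x, y), 0)
      ((\<lambda>m. (code p, prod_encode (x, m), v m)) ` {..<y})"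
    show ?case
    proof (rule derivableI[where A = A and m = 0])
      show "derivable i g z" if "z \<in> A" for z
        using that y v Mu.IH by (auto simp: A_def)
      fix d :: "(nat \<times> nat \<times> nat) list" and n
      assume "A \<subseteq> set d"
      then have "(code p, prod_encode (x, y), 0) \<in> set d"
        "\<And>j. j < y \<Longrightarrow> (code p, prod_encode (x, j), v j) \<in> set d \<and> v j \<noteq> 0"
        using v by (auto simp: A_def)
      then show "justified i (g \<restriction> n) d (code (Mu p), x, y)"
        unfolding justified_code by blast
    qed (simp add: A_def)
  next
    case Zero
    then show ?case using axiom[of "(code Zero, x, y)"] by (simp add: justified_def)
  next
    case Succ
    then show ?case using axiom[of "(code Succ, x, y)"] by (simp add: justified_def)
  next
    case Fst
    then show ?case using axiom[of "(code Fst, x, y)"] by (simp add: justified_def)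
  next
    case Snd
    then show ?case using axiom[of "(code Snd, x, y)"] by (simp add: justified_def)
  qed
qed

text \<open>A binary string stays in the tree until a derivation refutes \<open>D\<close> from the
  string alone. Bounding code and argument by the length of the string makes the tree computable and
  prefix-closed; a refutation is finite and is thus noticed at some length.\<close>

lemma Pi01_class_decidable:
  fixes D :: "baire \<Rightarrow> 'e::encodable \<Rightarrow> bool"
  assumes "decidable_on UNIV D"
  shows "Pi01_class {f. (\<forall>n. f n \<le> 1) \<and> (\<forall>x. D f x)}"
proof -
  obtain p where p: "\<And>g x. run p g (enc x) = Some (of_bool (D g x))"
    using assms unfolding decidable_on_def computable_on_def by auto
  define T :: "nat list set" where "T = {\<sigma>. (\<forall>b\<in>set \<sigma>. b \<le> 1) \<and>
    (\<forall>c<length \<sigma>. \<forall>x<length \<sigma>. \<not> (valid 0 \<sigma> (unenc c) \<and> (code p, x, 0 :: nat) \<in> set (unenc c)))}"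
  have "decidable_on UNIV (\<lambda>g \<sigma>. \<sigma> \<in> T)"
    unfolding T_def mem_Collect_eq by (intro comp_intros)
  then obtain q where "\<And>\<sigma>. run q (\<lambda>_. 0) (enc \<sigma>) = Some (of_bool (\<sigma> \<in> T))"
    unfolding decidable_on_def computable_on_def by auto
  then have "computable_on_strings (\<lambda>\<sigma>. of_bool (\<sigma> \<in> T))"
    unfolding computable_on_strings_def by (metis enc_nat_list)
  moreover have "\<tau> \<in> T" if "\<sigma> \<in> T" "prefix \<tau> \<sigma>" for \<sigma> \<tau>
  proof -
    have "set \<tau> \<subseteq> set \<sigma>" "length \<tau> \<le> length \<sigma>"
      using that(2) by (auto simp: set_mono_prefix prefix_length_le)
    with that(1) show ?thesis
      unfolding T_def using valid_mono[OF _ that(2)] by fastforce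
  qed
  ultimately have "computable_tree T" unfolding computable_tree_def by blast
  moreover have "set \<sigma> \<subseteq> {0, 1}" if "\<sigma> \<in> T" for \<sigma>
    using that unfolding T_def by (auto simp: le_Suc_eq)
  moreover have "{f. (\<forall>n. f n \<le> 1) \<and> (\<forall>x. D f x)} = {f. \<forall>n. f \<restriction> n \<in> T}"
  proof (intro equalityI subsetI)
    fix f assume "f \<in> {f. (\<forall>n. f n \<le> 1) \<and> (\<forall>x. D f x)}"
    then have bin: "\<And>n. f n \<le> 1" and D: "\<And>x. D f x" by auto
    have 1: "\<not> (valid 0 (f \<restriction> n) d \<and> (code p, x, 0) \<in> set d)" for n d x
    proof
      assume *: "valid 0 (f \<restriction> n) d \<and> (code p, x, 0) \<in> set d"
      have "run p f x = Some 0"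
        using valid_sound[of 0 "f \<restriction> n" d f] * by auto
      with p[of f "unenc x"] D[of "unenc x"] show False by simp
    qed
    have 2: "\<forall>b\<in>set (f \<restriction> n). b \<le> 1" for n
      using bin by (auto simp: initial_def)
    show "f \<in> {f. \<forall>n. f \<restriction> n \<in> T}"
      unfolding T_def mem_Collect_eq by (intro conjI allI impI 1 2)
  next
    fix f assume "f \<in> {f. \<forall>n. f \<restriction> n \<in> T}"
    then have T: "\<And>n. f \<restriction> n \<in> T" by simp
    have "f n \<le> 1" for n
      using T[of "Suc n"] by (auto simp: T_def initial_def)
    moreover have "D f x" for x
    proof (rule ccontr)
      assume "\<not> D f x"
      with p[of f x] have "run p (omit_column 0 f) (enc x) = Some 0" by simp
      from run_derivable[OF this] obtain d n
        where d: "valid 0 (f \<restriction> n) d" "(code p, enc x, 0) \<in> set d"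
        unfolding derivable_def by blast
      \<comment> \<open>Long enough for \<open>d\<close> to be valid and for \<open>enc d\<close>
        and \<open>enc x\<close> to lie below the length.\<close>
      define N where "N = n + Suc (enc d) + Suc (enc x)"
      have "valid 0 (f \<restriction> N) d"
using d(1) by (rule valid_mono) (simp add: prefix_initial N_def)
      moreover have "\<forall>c<length (f \<restriction> N). \<forall>x<length (f \<restriction> N).
          \<not> (valid 0 (f \<restriction> N) (unenc c) \<and> (code p, x, 0 :: nat) \<in> set (unenc c))"
        using T[of N] unfolding T_def mem_Collect_eq by (rule conjunct2)
      from this[rule_format, of "enc d" "enc x"]
      have "\<not> (valid 0 (f \<restriction> N) d \<and> (code p, enc x, 0) \<in> set d)"
        by (simp add: N_def)
      ultimately show False using d(2) by simp
    qed
    ultimately show "f \<in> {f. (\<forall>n. f n \<le> 1) \<and> (\<forall>x. D f x)}" by blast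
  qed
  ultimately show ?thesis unfolding Pi01_class_def by blast
qed

section \<open>Independent columns\<close>

text \<open>
  Requirement \<open>k\<close>, which decodes to \<open>(i, e)\<close>, asks that program \<open>e\<close> with column \<open>i\<close> of the oracle blanked
  out does not compute an element of \<open>S\<^sub>i\<close>. The entry \<open>(t, \<rho>, f)\<close> of the stack at height \<open>k\<close> was pushed at
  stage \<open>t\<close>. While \<open>f = 0\<close> it waits for the computation at \<open>t\<close>, with \<open>\<rho>\<close> the string protected by the entries
  below; once it acts, \<open>f\<close> is \<open>1\<close>, \<open>\<rho>\<close> is the string it protects, and all entries above are discarded.
  Stage numbers code all candidates for acting, each infinitely often, so that no search is needed.
\<close>

type_synonym entry = "nat \<times> nat list \<times> nat"

text \<open>The state stores the stack with its top at the head of the list, so the lowest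
  \<open>k\<close> entries are the last ones.\<close>

definition bottom :: "nat \<Rightarrow> 'a list \<Rightarrow> 'a list" where
  "bottom k S = drop (length S - k) S"

text \<open>\<open>P\<close> is the bit of column \<open>i\<close> in the row given by the stage of
  the entry. By \<open>d\<close>, the program, blind to column \<open>i\<close>, outputs at that row
  a value other than bit \<open>P\<close> of \<open>\<rho>\<close>; deciding this bit defeats the
  program.\<close>

definition can_act ::
    "nat \<Rightarrow> nat list \<Rightarrow> (nat \<times> nat \<times> nat) list \<Rightarrow> entry list \<times> (nat \<times> nat) list \<Rightarrow> bool" where
  "can_act k \<rho> d s = (let S = fst s; E = hd (bottom (Suc k) S); i = fst (prod_decode k);
      P = prod_encode (i, fst E) in
    k < length S \<and> snd (snd E) = 0 \<and> prefix (fst (snd E)) \<rho> \<and>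
    (\<forall>q\<in>set (snd s). fst q < length \<rho> \<longrightarrow> hd (drop (fst q) \<rho>) = snd q) \<and> (\<forall>b\<in>set \<rho>. b \<le> 1) \<and>
    P < length \<rho> \<and> valid (Suc i) \<rho> d \<and>
    (\<exists>z\<in>set d. z = (snd (prod_decode k), fst E, snd (snd z)) \<and> snd (snd z) \<noteq> hd (drop P \<rho>)))"

definition act :: "nat \<Rightarrow> nat list \<Rightarrow> entry list \<times> (nat \<times> nat) list \<Rightarrow> entry list \<times> (nat \<times> nat) list" where
  "act k \<rho> s = (let S = fst s; t = fst (hd (bottom (Suc k) S)); P = prod_encode (fst (prod_decode k), t) in
    ((t, \<rho>, 1) # bottom k S, (P, hd (drop P \<rho>)) # snd s))"

definition candidate :: "nat \<Rightarrow> nat \<times> nat list \<times> (nat \<times> nat \<times> nat) list" where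
  "candidate u = fst (unenc u :: (nat \<times> nat list \<times> (nat \<times> nat \<times> nat) list) \<times> nat)"

definition step :: "nat \<Rightarrow> entry list \<times> (nat \<times> nat) list \<Rightarrow> entry list \<times> (nat \<times> nat) list" where
  "step u s = (if can_act (fst (candidate u)) (fst (snd (candidate u))) (snd (snd (candidate u))) s
    then act (fst (candidate u)) (fst (snd (candidate u))) s
    else ((u, if fst s = [] then [] else fst (snd (hd (fst s))), 0) # fst s, snd s))"

definition state :: "nat \<Rightarrow> entry list \<times> (nat \<times> nat) list" where
  "state u = rec_nat ([], []) step u"

definition decided :: "nat \<Rightarrow> (nat \<times> nat) list" where
  "decided u = snd (state u)"

section \<open>Computability of the construction\<close>

lemma decidable_on_prefix [comp_intros]:
  assumes "computable_on G a" "computable_on G b"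
  shows "decidable_on G (\<lambda>g x. prefix (a g x) (b g x))"
proof -
  have eq: "prefix xs ys \<longleftrightarrow> length xs \<le> length ys \<and>
      (\<forall>j<length xs. hd (drop j ys) = hd (drop j xs))" for xs ys :: "'b list"
  proof
    assume "length xs \<le> length ys \<and> (\<forall>j<length xs. hd (drop j ys) = hd (drop j xs))"
    then have "xs = take (length xs) ys"
      by (intro nth_equalityI) (auto simp: hd_drop_conv_nth)
    then show "prefix xs ys" by (metis take_is_prefix)
  qed (auto simp: prefix_def hd_drop_conv_nth nth_append)
  show ?thesis unfolding eq
    by (intro comp_intros assms computable_on_comp[OF assms(1)] computable_on_comp[OF assms(2)])
qed

lemma computable_on_decided [comp_intros]:
  assumes "computable_on G u"
  shows "computable_on G (\<lambda>g x. decided (u g x))"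
proof -
  have bottom: "computable_on G (\<lambda>g x. bottom (a g x) (b g x))"
    if "computable_on G a" "computable_on G b"
    for a and b :: "baire \<Rightarrow> 'y::encodable \<Rightarrow> 'z::encodable list"
    unfolding bottom_def by (intro comp_intros that)
  have "decidable_on G (\<lambda>g z. can_act (fst z) (fst (snd z)) (fst (snd (snd z))) (snd (snd (snd z))))"
    unfolding can_act_def Let_def by (intro bottom comp_intros)
  then have can_act: "decidable_on G (\<lambda>g x. can_act (k g x) (r g x) (d g x) (s g x))"
    if "computable_on G k" "computable_on G r" "computable_on G d" "computable_on G s"
    for k r d and s :: "baire \<Rightarrow> 'y::encodable \<Rightarrow> entry list \<times> (nat \<times> nat) list"
    using decidable_on_comp[of G _ "\<lambda>g x. (k g x, r g x, d g x, s g x)"] that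
    by (fastforce intro: comp_intros)
  have "computable_on G (\<lambda>g z. step (fst z) (snd z))"
    unfolding step_def act_def candidate_def Let_def by (intro can_act bottom comp_intros)
  then have step: "computable_on G (\<lambda>g x. step (k g x) (s g x))"
    if "computable_on G k" "computable_on G s"
    for k and s :: "baire \<Rightarrow> 'y::encodable \<Rightarrow> entry list \<times> (nat \<times> nat) list"
    using computable_on_comp[of G _ "\<lambda>g x. (k g x, s g x)"] that
    by (fastforce intro: comp_intros)
  show ?thesis unfolding decided_def state_def
    by (intro step comp_intros assms)
qed

text \<open>Reversed so that the entry at index \<open>k\<close> belongs to requirement
  \<open>k\<close>.\<close>

definition stack :: "nat \<Rightarrow> entry list" where
  "stack u = rev (fst (state u))"

abbreviation time :: "entry \<Rightarrow> nat" where "time E \<equiv> fst E"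
abbreviation str :: "entry \<Rightarrow> nat list" where "str E \<equiv> fst (snd E)"
abbreviation flag :: "entry \<Rightarrow> nat" where "flag E \<equiv> snd (snd E)"

definition position :: "nat \<Rightarrow> nat \<Rightarrow> nat" where
  "position k t = prod_encode (fst (prod_decode k), t)"

definition ready :: "nat \<Rightarrow> nat \<Rightarrow> nat list \<Rightarrow> (nat \<times> nat \<times> nat) list \<Rightarrow> bool" where
  "ready u k \<rho> d \<longleftrightarrow> k < length (stack u) \<and> flag (stack u ! k) = 0 \<and> prefix (str (stack u ! k)) \<rho> \<and>
    (\<forall>(P, v)\<in>set (decided u). P < length \<rho> \<longrightarrow> \<rho> ! P = v) \<and> (\<forall>b\<in>set \<rho>. b \<le> 1) \<and>
    position k (time (stack u ! k)) < length \<rho> \<and> valid (Suc (fst (prod_decode k))) \<rho> d \<and>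
    (\<exists>y. (snd (prod_decode k), time (stack u ! k), y) \<in> set d \<and>
      y \<noteq> \<rho> ! position k (time (stack u ! k)))"

lemma hd_bottom: "k < length S \<Longrightarrow> hd (bottom (Suc k) S) = rev S ! k"
  by (simp add: bottom_def hd_drop_conv_nth rev_nth)

lemma rev_bottom: "rev (bottom k S) = take k (rev S)"
  by (simp add: bottom_def take_rev)

lemma can_act_iff_ready: "can_act k \<rho> d (state u) \<longleftrightarrow> ready u k \<rho> d"
  unfolding can_act_def ready_def stack_def Let_def position_def decided_def length_rev
  by (rule conj_cong[OF refl]) (auto simp: hd_bottom hd_drop_conv_nth Bex_def)

lemma act_eq:
  assumes "candidate u = (k, \<rho>, d)" "ready u k \<rho> d"
  shows "stack (Suc u) = take k (stack u) @ [(time (stack u ! k), \<rho>, 1)]"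
    and "decided (Suc u) =
      (position k (time (stack u ! k)), \<rho> ! position k (time (stack u ! k))) # decided u"
  using assms
  by (auto simp: stack_def decided_def state_def step_def can_act_iff_ready[unfolded state_def]
      act_def Let_def rev_bottom ready_def hd_bottom position_def hd_drop_conv_nth)

lemma push_eq:
  assumes "candidate u = (k, \<rho>, d)" "\<not> ready u k \<rho> d"
  shows "stack (Suc u) = stack u @ [(u, if stack u = [] then [] else str (last (stack u)), 0)]"
    and "decided (Suc u) = decided u"
  using assms
  by (auto simp: stack_def decided_def state_def step_def can_act_iff_ready[unfolded state_def] last_rev)

lemma stack_decided_cases:
  obtains (act) k \<rho> d where "candidate u = (k, \<rho>, d)" "ready u k \<rho> d"
      "stack (Suc u) = take k (stack u) @ [(time (stack u ! k), \<rho>, 1)]"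
      "decided (Suc u) =
        (position k (time (stack u ! k)), \<rho> ! position k (time (stack u ! k))) # decided u"
  | (push) "stack (Suc u) = stack u @ [(u, if stack u = [] then [] else str (last (stack u)), 0)]"
      "decided (Suc u) = decided u"
  using act_eq push_eq by (metis prod_cases3)

section \<open>Invariants of the construction\<close>

lemma length_le_enc: "length xs \<le> enc xs"
proof (induction xs)
  case (Cons x xs)
  then show ?case using le_prod_encode_2[of "enc xs" "enc x"] by simp
qed simp

text \<open>Protected strings stay no longer than the current stage, so an entry pushed at stage
  \<open>u\<close> has its bit, which lies in row \<open>u\<close>, outside all of them.\<close>

lemma candidate_length_le: "candidate u = (k, \<rho>, d) \<Longrightarrow> length \<rho> \<le> u"
proof -
  assume c: "candidate u = (k, \<rho>, d)"
  obtain w pad where w: "unenc u = (w :: nat \<times> nat list \<times> (nat \<times> nat \<times> nat) list, pad :: nat)"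
    by (metis surj_pair)
  then have "u = enc (w, pad)" by (metis enc_unenc)
  moreover have "w = (k, \<rho>, d)" using c w by (simp add: candidate_def)
  ultimately have u: "u = prod_encode (prod_encode (k, prod_encode (enc \<rho>, enc d)), pad)" by simp
  have "length \<rho> \<le> enc \<rho>" by (rule length_le_enc)
  also have "\<dots> \<le> prod_encode (enc \<rho>, enc d)" by (rule le_prod_encode_1)
  also have "\<dots> \<le> prod_encode (k, prod_encode (enc \<rho>, enc d))" by (rule le_prod_encode_2)
  also have "\<dots> \<le> u" unfolding u by (rule le_prod_encode_1)
  finally show ?thesis .
qed

text \<open>The evidence left by an action: a derivation on the protected string against a decided
  bit.\<close>

definition certified :: "nat \<Rightarrow> nat \<Rightarrow> entry \<Rightarrow> bool" where
  "certified u k E \<longleftrightarrow> position k (time E) < length (str E) \<and>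
    (position k (time E), str E ! position k (time E)) \<in> set (decided u) \<and>
    (\<exists>d y. valid (Suc (fst (prod_decode k))) (str E) d \<and> (snd (prod_decode k), time E, y) \<in> set d \<and>
      y \<noteq> str E ! position k (time E))"

lemma decided_mono: "u \<le> u' \<Longrightarrow> set (decided u) \<subseteq> set (decided u')"
proof (induction rule: dec_induct)
  case (step n)
  then show ?case by (cases n rule: stack_decided_cases) auto
qed simp

text \<open>A waiting entry has its row \<open>time E\<close> undecided in every column, and its
  string ends before its bit. Every string agrees with all decided bits, also with those decided by
  higher entries after the string was fixed.\<close>

definition entry_ok :: "nat \<Rightarrow> nat \<Rightarrow> bool" where
  "entry_ok u k \<longleftrightarrow> (let E = stack u ! k in
    time E < u \<and> length (str E) \<le> u \<and> (\<forall>b\<in>set (str E). b \<le> 1) \<and>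
    (\<forall>j<k. prefix (str (stack u ! j)) (str E) \<and> time (stack u ! j) < time E) \<and>
    (flag E = 0 \<longrightarrow> length (str E) \<le> time E \<and> (\<forall>(P, v)\<in>set (decided u). snd (prod_decode P) \<noteq> time E)) \<and>
    (\<forall>(P, v)\<in>set (decided u). P < length (str E) \<longrightarrow> str E ! P = v) \<and>
    (flag E \<noteq> 0 \<longrightarrow> certified u k E))"

lemma snd_position [simp]: "snd (prod_decode (position k t)) = t"
  by (simp add: position_def)

lemma time_le_position: "t \<le> position k t"
  unfolding position_def by (rule le_prod_encode_2)

lemma invariant:
  "(\<forall>k<length (stack u). entry_ok u k) \<and> distinct (map fst (decided u)) \<and>
    (\<forall>(P, v)\<in>set (decided u). snd (prod_decode P) < u \<and> v \<le> 1)"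
proof (induction u)
  case 0
  show ?case by (simp add: stack_def decided_def state_def)
next
  case (Suc u)
  then have ok: "\<And>k. k < length (stack u) \<Longrightarrow> entry_ok u k"
    and dist: "distinct (map fst (decided u))"
    and bound: "\<And>P v. (P, v) \<in> set (decided u) \<Longrightarrow> snd (prod_decode P) < u \<and> v \<le> 1"
    by auto
  show ?case
  proof (cases u rule: stack_decided_cases)
    case (act k \<rho> d)
    define E where "E = stack u ! k"
    define P where "P = position k (time E)"
    from act(2) have k: "k < length (stack u)" and flag: "flag E = 0" and pre: "prefix (str E) \<rho>"
      and cons: "\<And>P v. (P, v) \<in> set (decided u) \<Longrightarrow> P < length \<rho> \<Longrightarrow> \<rho> ! P = v"
      and bin: "\<And>b. b \<in> set \<rho> \<Longrightarrow> b \<le> 1" and P: "P < length \<rho>"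
      and d: "valid (Suc (fst (prod_decode k))) \<rho> d"
        "\<exists>y. (snd (prod_decode k), time E, y) \<in> set d \<and> y \<noteq> \<rho> ! P"
      unfolding ready_def E_def P_def by auto
    have stack': "stack (Suc u) = take k (stack u) @ [(time E, \<rho>, 1)]"
      and decided': "decided (Suc u) = (P, \<rho> ! P) # decided u"
      using act unfolding E_def P_def by auto
    have E: "time E < u" "length (str E) \<le> time E"
      "\<And>P v. (P, v) \<in> set (decided u) \<Longrightarrow> snd (prod_decode P) \<noteq> time E"
      "\<And>j. j < k \<Longrightarrow> prefix (str (stack u ! j)) (str E) \<and> time (stack u ! j) < time E"
      using ok[OF k] flag unfolding entry_ok_def Let_def E_def[symmetric] by auto
    \<comment> \<open>The row of a waiting entry is still undecided, so no bit is decided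
      twice.\<close>
    have fresh: "P \<notin> fst ` set (decided u)"
      using E(3) by (force simp: P_def)
    have "entry_ok (Suc u) j" if "j < length (stack (Suc u))" for j
    proof (cases "j < k")
      case True
      then have j: "j < length (stack u)" "stack (Suc u) ! j = stack u ! j"
        "\<And>l. l < j \<Longrightarrow> stack (Suc u) ! l = stack u ! l"
        using k by (auto simp: stack' nth_append)
      \<comment> \<open>The lower strings are prefixes of the string of \<open>E\<close>, whose
        length is at most \<open>time E \<le> P\<close>, so the new bit cannot conflict with
        them.\<close>
      have "length (str (stack u ! j)) \<le> P"
        using E(2) E(4)[OF True] prefix_length_le time_le_position[of "time E" k]
        unfolding P_def by fastforce
      with ok[OF j(1)] E(4)[OF True] show ?thesis
        unfolding entry_ok_def Let_def decided' certified_def j(2)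
        by (auto simp: j(3) P_def)
    next
      case False
      with that k have j: "j = k" "stack (Suc u) ! k = (time E, \<rho>, 1)"
        by (auto simp: stack' nth_append)
      have l: "stack (Suc u) ! l = stack u ! l" if "l < k" for l
        using that k by (simp add: stack' nth_append)
      have "prefix (str (stack u ! l)) \<rho>" if "l < k" for l
        using E(4)[OF that] pre prefix_order.trans by blast
      then show ?thesis
        unfolding entry_ok_def Let_def j certified_def decided'
        using E cons bin P d candidate_length_le[OF act(1)]
        by (auto simp: l P_def)
    qed
    moreover have "\<rho> ! P \<le> 1" using bin P by simp
    ultimately show ?thesis
      using dist fresh bound E(1) unfolding decided' by (force simp: P_def intro: less_SucI)
  next
    case push
    \<comment> \<open>The new entry inherits the string of the top entry, which extends all others.
      Its row \<open>u\<close> is fresh, because decided rows lie below \<open>u\<close>.\<close>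
    define R where "R = (if stack u = [] then [] else str (last (stack u)))"
    have stack': "stack (Suc u) = stack u @ [(u, R, 0)]" and decided': "decided (Suc u) = decided u"
      using push unfolding R_def by auto
    have "entry_ok (Suc u) j" if "j < length (stack (Suc u))" for j
    proof (cases "j < length (stack u)")
      case True
      then have j: "stack (Suc u) ! j = stack u ! j" "\<And>l. l < j \<Longrightarrow> stack (Suc u) ! l = stack u ! l"
        by (auto simp: stack' nth_append)
      from ok[OF True] show ?thesis
        unfolding entry_ok_def Let_def decided' certified_def j(1) by (auto simp: j(2))
    next
      case False
      with that have j: "j = length (stack u)" "stack (Suc u) ! length (stack u) = (u, R, 0)"
        by (auto simp: stack')
      show ?thesis
      proof (cases "stack u = []")
        case True
        then show ?thesis
          unfolding entry_ok_def Let_def j decided' using bound by (force simp: R_def)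
      next
        case False
        define k where "k = length (stack u) - 1"
        have k: "k < length (stack u)" "R = str (stack u ! k)"
          using False by (auto simp: k_def R_def last_conv_nth)
        have "prefix (str (stack u ! l)) R \<and> time (stack u ! l) < u" if "l < length (stack u)" for l
          using that ok[OF that] ok[OF k(1)] unfolding entry_ok_def Let_def k(2)
          by (cases "l = k") (auto simp: k_def)
        then show ?thesis
          using ok[OF k(1)] bound unfolding entry_ok_def Let_def j decided' certified_def k(2)
          by (force simp: stack' nth_append)
      qed
    qed
    with dist bound show ?thesis unfolding decided' by (force intro: less_SucI)
  qed
qed

section \<open>Stabilisation of the stack and the limit sequence\<close>

definition stable :: "nat \<Rightarrow> entry \<Rightarrow> bool" where
  "stable k E \<longleftrightarrow> (\<exists>u0. \<forall>u\<ge>u0. k < length (stack u) \<and> stack u ! k = E)"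

text \<open>Finite injury: once the entries below \<open>k\<close> are final, none of them can act,
  since acting raises a flag from 0 to 1. From then on entry \<open>k\<close> is never discarded,
  and it acts at most once.\<close>

lemma stable_exists: "\<exists>u0. \<forall>u\<ge>u0. k \<le> length (stack u) \<and> take k (stack u) = take k (stack u0)"
proof (induction k)
  case (Suc k)
  then obtain u0 where u0: "\<And>u. u \<ge> u0 \<Longrightarrow> k \<le> length (stack u) \<and> take k (stack u) = take k (stack u0)"
    by blast
  have nth: "stack (Suc u) ! j = stack u ! j" if "u \<ge> u0" "j < k" for u j
    using u0[OF that(1)] u0[of "Suc u"] that by (metis le_Suc_eq nth_take)
  have late: "k \<le> k'" if "u \<ge> u0" "candidate u = (k', \<rho>, d)" "ready u k' \<rho> d" for u k' \<rho> d
  proof (rule ccontr)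
    assume "\<not> k \<le> k'"
    then have "k' < k" by simp
    have "flag (stack (Suc u) ! k') = 1" "flag (stack u ! k') = 0"
      using act_eq(1)[OF that(2,3)] that(3) by (auto simp: ready_def nth_append)
    with nth[OF that(1) \<open>k' < k\<close>] show False by simp
  qed
  have len: "Suc k \<le> length (stack u)" if "u \<ge> Suc u0" for u
  proof -
    from that obtain v where v: "u = Suc v" "v \<ge> u0" by (cases u) auto
    show ?thesis
    proof (cases v rule: stack_decided_cases)
      case (act k' \<rho> d)
      with late[OF v(2)] show ?thesis by (auto simp: v ready_def)
    next
      case push
      with u0[OF v(2)] show ?thesis by (simp add: v)
    qed
  qed
  have keep: "stack (Suc u) ! k = stack u ! k \<or> flag (stack u ! k) = 0 \<and> flag (stack (Suc u) ! k) \<noteq> 0"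
    if "u \<ge> Suc u0" for u
  proof (cases u rule: stack_decided_cases)
    case (act k' \<rho> d)
    with late[of u k' \<rho> d] that len[OF that] show ?thesis
      by (cases "k = k'") (auto simp: ready_def nth_append)
  next
    case push
    with len[OF that] show ?thesis by (simp add: nth_append)
  qed
  \<comment> \<open>A raised flag freezes the entry; if it is never raised, the entry is constant
    from stage \<open>Suc u0\<close> on.\<close>
  have "\<exists>u1\<ge>Suc u0. \<forall>u\<ge>u1. stack u ! k = stack u1 ! k"
  proof (cases "\<exists>u1\<ge>Suc u0. flag (stack u1 ! k) \<noteq> 0")
    case True
    then obtain u1 where u1: "u1 \<ge> Suc u0" "flag (stack u1 ! k) \<noteq> 0" by blast
    have "stack u ! k = stack u1 ! k" if "u \<ge> u1" for u
      using that
    proof (induction rule: dec_induct)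
      case (step n)
      with keep[of n] u1 show ?case by auto
    qed simp
    with u1 show ?thesis by blast
  next
    case False
    have "stack u ! k = stack (Suc u0) ! k" if "u \<ge> Suc u0" for u
      using that
    proof (induction rule: dec_induct)
      case (step n)
      with keep[of n] False show ?case by auto
    qed simp
    then show ?thesis by blast
  qed
  then obtain u1 where u1: "u1 \<ge> Suc u0" "\<And>u. u \<ge> u1 \<Longrightarrow> stack u ! k = stack u1 ! k" by blast
  have "take (Suc k) (stack u) = take (Suc k) (stack u1)" if "u \<ge> u1" for u
  proof -
    have "take k (stack u) = take k (stack u1)"
      using u0[of u] u0[of u1] u1(1) that by (metis Suc_leD le_trans)
    moreover have "k < length (stack u)" "k < length (stack u1)"
      using len[of u] len[of u1] u1(1) that by simp_all
    ultimately show ?thesis using u1(2)[OF that] by (simp only: take_Suc_conv_app_nth)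
  qed
  moreover have "Suc k \<le> length (stack u)" if "u \<ge> u1" for u
    using len u1(1) that by simp
  ultimately show ?case by blast
qed simp

lemma stable_Ex: "\<exists>E. stable k E"
proof -
  obtain u0 where u0: "\<forall>u\<ge>u0. Suc k \<le> length (stack u) \<and> take (Suc k) (stack u) = take (Suc k) (stack u0)"
    using stable_exists by blast
  have "k < length (stack u) \<and> stack u ! k = stack u0 ! k" if "u \<ge> u0" for u
    using u0[rule_format, OF that] by (metis Suc_le_eq lessI nth_take)
  then show ?thesis unfolding stable_def by blast
qed

text \<open>\<open>X\<close> extends the final protected strings and the decided bits. If a program
  computes \<open>h\<close> without column \<open>i\<close>, the final entry of its requirement
  either has acted, and its derivation contradicts a decided bit, or waits for ever. The latter is
  impossible, as the computation of \<open>h\<close> supplies a candidate.\<close>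

theorem independent_columns:
  "\<exists>X. (\<forall>P. X P \<le> 1) \<and> (\<forall>u P v. (P, v) \<in> set (decided u) \<longrightarrow> X P = v) \<and>
    (\<forall>i h. turing_le h (omit_column (Suc i) X) \<longrightarrow>
      (\<exists>u t v. (prod_encode (i, t), v) \<in> set (decided u) \<and> h t \<noteq> v))"
proof -
  obtain ent where ent: "\<And>k. stable k (ent k)" using stable_Ex by metis
  have ev: "\<exists>u\<ge>u0. \<forall>k\<in>K. k < length (stack u) \<and> stack u ! k = ent k" if "finite K" for K u0
  proof -
    from ent obtain w where w: "\<And>k u. u \<ge> w k \<Longrightarrow> k < length (stack u) \<and> stack u ! k = ent k"
      unfolding stable_def by metis
    have "w k \<le> max u0 (Max (w ` K))" if "k \<in> K" for k
      using that \<open>finite K\<close> by (simp add: le_max_iff_disj)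
    with w show ?thesis by (meson max.cobounded1)
  qed
  have chain: "prefix (str (ent j)) (str (ent k))" if "j \<le> k" for j k
  proof (cases "j = k")
    case False
    obtain u where u: "k < length (stack u)" "stack u ! k = ent k" "stack u ! j = ent j"
      using ev[of "{j, k}" 0] by auto
    with invariant[of u] have "entry_ok u k" by blast
    then have "\<forall>l<k. prefix (str (stack u ! l)) (str (ent k))"
      unfolding entry_ok_def Let_def u(2) by blast
    with False that show ?thesis using u(3) by (metis le_neq_implies_less)
  qed simp
  have consistent: "str (ent k) ! P = v" if "(P, v) \<in> set (decided u)" "P < length (str (ent k))" for k u P v
  proof -
    obtain u' where u': "u' \<ge> u" "k < length (stack u')" "stack u' ! k = ent k"
      using ev[of "{k}" u] by auto
    with invariant[of u'] have "entry_ok u' k" by blast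
    moreover have "(P, v) \<in> set (decided u')" using that decided_mono[OF u'(1)] by blast
    ultimately show ?thesis
      using u' that unfolding entry_ok_def Let_def by auto
  qed
  have functional: "v = v'" if "(P, v) \<in> set (decided u)" "(P, v') \<in> set (decided u')" for u u' P v v'
  proof -
    have "(P, v) \<in> set (decided (max u u'))" "(P, v') \<in> set (decided (max u u'))"
      using that decided_mono by (meson max.cobounded1 max.cobounded2 subsetD)+
    moreover have "distinct (map fst (decided (max u u')))" using invariant by blast
    ultimately show ?thesis by (meson eq_key_imp_eq_value)
  qed
  have bin: "b \<le> 1" if "b \<in> set (str (ent k))" for b k
  proof -
    obtain u where u: "k < length (stack u)" "stack u ! k = ent k" using ev[of "{k}" 0] by auto
    with invariant[of u] have "entry_ok u k" by blast
    with u that show ?thesis unfolding entry_ok_def Let_def by auto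
  qed
  \<comment> \<open>Final strings are nested and agree with all decided bits, so the cases never
    conflict; bits reached by neither are 0.\<close>
  define X where "X P = (if \<exists>u v. (P, v) \<in> set (decided u) then THE v. \<exists>u. (P, v) \<in> set (decided u)
    else if \<exists>k. P < length (str (ent k)) then str (ent (LEAST k. P < length (str (ent k)))) ! P else 0)" for P
  have X_decided: "X P = v" if "(P, v) \<in> set (decided u)" for P v u
  proof -
    have "(THE v. \<exists>u. (P, v) \<in> set (decided u)) = v"
      by (rule the_equality) (use that functional in blast)+
    with that show ?thesis unfolding X_def by auto
  qed
  have X_str: "X P = str (ent k) ! P" if "P < length (str (ent k))" for P k
  proof (cases "\<exists>u v. (P, v) \<in> set (decided u)")
    case True
    with X_decided consistent that show ?thesis by blast
  next
    case False
    define l where "l = (LEAST k. P < length (str (ent k)))"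
    have "P < length (str (ent l))" "l \<le> k"
      unfolding l_def using that by (rule LeastI, rule Least_le)
    with chain[of l k] False that show ?thesis
      unfolding X_def l_def[symmetric] by (auto simp: prefix_def nth_append)
  qed
  have X_bin: "X P \<le> 1" for P
  proof (cases "\<exists>u v. (P, v) \<in> set (decided u)")
    case True
    then obtain u v where "(P, v) \<in> set (decided u)" by blast
    with X_decided[OF this] invariant[of u] show ?thesis by auto
  next
    case False
    show ?thesis
    proof (cases "\<exists>k. P < length (str (ent k))")
      case True
      then obtain k where "P < length (str (ent k))" by blast
      with X_str[OF this] bin[OF nth_mem] show ?thesis by metis
    qed (use False in \<open>simp add: X_def\<close>)
  qed
  have "\<exists>u t v. (prod_encode (i, t), v) \<in> set (decided u) \<and> h t \<noteq> v"
    if h: "turing_le h (omit_column (Suc i) X)" for i h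
  proof -
    obtain p where p: "\<And>t. run p (omit_column (Suc i) X) t = Some (h t)"
      using h unfolding turing_le_iff_run by blast
    define k where "k = prod_encode (i, code p)"
    obtain u0 where u0: "\<And>u. u \<ge> u0 \<Longrightarrow> k < length (stack u) \<and> stack u ! k = ent k"
      using ent[of k] unfolding stable_def by blast
    define t where "t = time (ent k)"
    define P where "P = position k t"
    have P_eq: "P = prod_encode (i, t)" by (simp add: P_def position_def k_def)
    have ok: "entry_ok u k" if "u \<ge> u0" for u
      using invariant[of u] u0[OF that] by blast
    show ?thesis
    proof (cases "flag (ent k) = 0")
      case False
      then have "certified u0 k (ent k)"
        using ok[OF order_refl] u0[OF order_refl] unfolding entry_ok_def Let_def by simp
      then obtain d y where "(P, str (ent k) ! P) \<in> set (decided u0)" "valid (Suc i) (str (ent k)) d"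
        "(code p, t, y) \<in> set d" and y: "y \<noteq> str (ent k) ! P"
        unfolding certified_def t_def[symmetric] P_def[symmetric] by (auto simp: k_def)
      moreover from this valid_sound[of "Suc i" "str (ent k)" d X] X_str
      have "run p (omit_column (Suc i) X) t = Some y" by fastforce
      ultimately show ?thesis using p[of t] unfolding P_eq by auto
    next
      case True
      have undecided: "(P, v) \<notin> set (decided u)" for u v
      proof
        assume "(P, v) \<in> set (decided u)"
        then have "(P, v) \<in> set (decided (max u u0))"
          using decided_mono by (meson max.cobounded1 subsetD)
        with ok[of "max u u0"] u0[of "max u u0"] True show False
          unfolding entry_ok_def Let_def by (auto simp: P_def t_def)
      qed
      have len: "length (str (ent k)) \<le> P"
        using ok[OF order_refl] u0[OF order_refl] True time_le_position[of t k]
        unfolding entry_ok_def Let_def P_def t_def by auto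
      \<comment> \<open>Bit \<open>P\<close> is set against \<open>h t\<close>. It lies in the
        blanked column, so the computation is unchanged, and outside the waiting string, which
        remains a prefix of \<open>Y\<close>.\<close>
      define Y where "Y = X(P := if h t = 0 then 1 else 0)"
      have "omit_column (Suc i) Y = omit_column (Suc i) X"
        by (auto simp: omit_column_def Y_def P_eq)
      then have "run p (omit_column (Suc i) Y) t = Some (h t)" using p by simp
      from run_derivable[OF this] obtain d n
        where d: "valid (Suc i) (Y \<restriction> n) d" "(code p, t, h t) \<in> set d"
        unfolding derivable_def by blast
      define \<rho> where "\<rho> = Y \<restriction> (n + Suc P)"
      have \<rho>: "\<rho> ! m = Y m" "P < length \<rho>" if "m < length \<rho>" for m
        using that by (simp_all add: \<rho>_def)
      have "prefix (str (ent k)) \<rho>"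
      proof -
        have "str (ent k) = take (length (str (ent k))) \<rho>"
          using len X_str by (intro nth_equalityI) (auto simp: \<rho>_def Y_def)
        then show ?thesis by (metis take_is_prefix)
      qed
      moreover have "\<forall>(Q, v)\<in>set (decided u). Q < length \<rho> \<longrightarrow> \<rho> ! Q = v" for u
        using X_decided undecided by (auto simp: \<rho>_def Y_def)
      moreover have "\<forall>b\<in>set \<rho>. b \<le> 1"
        using X_bin by (auto simp: \<rho>_def Y_def initial_def)
      moreover have "valid (Suc i) \<rho> d"
        using d(1) by (rule valid_mono) (simp add: \<rho>_def prefix_initial)
      moreover have "P < length \<rho>" "h t \<noteq> \<rho> ! P"
        by (auto simp: \<rho>_def Y_def)
      ultimately have ready: "ready u k \<rho> d" if "u \<ge> u0" for u
        using u0[OF that] True d(2)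
        unfolding ready_def P_def t_def by (auto simp: k_def)
      \<comment> \<open>The padding \<open>u0\<close> makes this stage at least \<open>u0\<close>,
        when entry \<open>k\<close> is already final.\<close>
      define u where "u = enc ((k, \<rho>, d), u0)"
      have "candidate u = (k, \<rho>, d)" by (simp add: candidate_def u_def del: enc_Pair)
      moreover have "u \<ge> u0" unfolding u_def enc_Pair by (metis enc_nat_def le_prod_encode_2)
      ultimately have "flag (stack (Suc u) ! k) = 1"
        using act_eq(1) ready[of u] u0[of u] by (simp add: nth_append)
      with u0[of "Suc u"] \<open>u \<ge> u0\<close> True show ?thesis by simp
    qed
  qed
  with X_bin X_decided show ?thesis by blast
qed

section \<open>The classes\<close>

definition satisfies :: "nat \<Rightarrow> nat \<Rightarrow> baire \<Rightarrow> bool" where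
  "satisfies u i f \<longleftrightarrow>
    (\<forall>q\<in>set (decided u). fst (prod_decode (fst q)) = i \<longrightarrow> f (snd (prod_decode (fst q))) = snd q)"

lemma satisfies_antimono: "satisfies u i f \<Longrightarrow> u' \<le> u \<Longrightarrow> satisfies u' i f"
  unfolding satisfies_def using decided_mono by blast

text \<open>Rows decided by stage \<open>u\<close> lie below \<open>u\<close>.\<close>

lemma satisfies_cong: "(\<And>t. t < u \<Longrightarrow> f t = h t) \<Longrightarrow> satisfies u i f \<longleftrightarrow> satisfies u i h"
  unfolding satisfies_def using invariant[of u] by fastforce

lemma decidable_on_satisfies [comp_intros]:
  assumes "computable_on G u" "computable_on G i" "computable_on G (\<lambda>g z. f g (fst z) (snd z))"
  shows "decidable_on G (\<lambda>g x. satisfies (u g x) (i g x) (f g x))"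
proof -
  have f: "computable_on G (\<lambda>g z. f g (fst z) (snd (prod_decode (fst (snd z)))))"
    if "computable_on G (\<lambda>g z. f g (fst z) (snd z))"
    using computable_on_comp[OF assms(3), of "\<lambda>g z. (fst z, snd (prod_decode (fst (snd z))))"]
    unfolding fst_conv snd_conv by this (intro comp_intros)
  show ?thesis unfolding satisfies_def
    by (intro comp_intros f assms computable_on_comp[OF assms(2)])
qed

definition solutions :: "nat \<Rightarrow> baire set" where
  "solutions i = {f. (\<forall>n. f n \<le> 1) \<and> (\<forall>u. satisfies u i f)}"

primrec count :: "baire \<Rightarrow> nat \<Rightarrow> nat" where
  "count c 0 = 0"
| "count c (Suc u) = count c u + (if c u = 0 then 0 else 1)"

primrec last_mark :: "baire \<Rightarrow> nat \<Rightarrow> nat" where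
  "last_mark c 0 = 0"
| "last_mark c (Suc u) = (if c u = 0 then last_mark c u else Suc u)"

lemma computable_on_count [comp_intros]:
  assumes "computable_on G (\<lambda>g z. c g (fst z) (snd z))" "computable_on G n"
  shows "computable_on G (\<lambda>g x. count (c g x) (n g x))"
proof -
  have eq: "count b m = rec_nat 0 (\<lambda>k r. r + (if b k = 0 then 0 else 1)) m" for b m
    by (induction m) auto
  have c: "computable_on G (\<lambda>g z. c g (fst z) (fst (snd z)))"
    using computable_on_comp[OF assms(1), of "\<lambda>g z. (fst z, fst (snd z))"]
    unfolding fst_conv snd_conv by this (intro comp_intros)
  show ?thesis unfolding eq by (intro comp_intros assms c)
qed

lemma computable_on_last_mark [comp_intros]:
  assumes "computable_on G (\<lambda>g z. c g (fst z) (snd z))" "computable_on G n"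
  shows "computable_on G (\<lambda>g x. last_mark (c g x) (n g x))"
proof -
  have eq: "last_mark b m = rec_nat 0 (\<lambda>k r. if b k = 0 then r else Suc k) m" for b m
    by (induction m) auto
  have c: "computable_on G (\<lambda>g z. c g (fst z) (fst (snd z)))"
    using computable_on_comp[OF assms(1), of "\<lambda>g z. (fst z, fst (snd z))"]
    unfolding fst_conv snd_conv by this (intro comp_intros)
  show ?thesis unfolding eq by (intro comp_intros assms c)
qed

lemma count_mono: "(\<And>s. c s \<noteq> 0 \<Longrightarrow> c' s \<noteq> 0) \<Longrightarrow> u \<le> u' \<Longrightarrow> count c u \<le> count c' u'"
proof -
  assume c: "\<And>s. c s \<noteq> 0 \<Longrightarrow> c' s \<noteq> 0" and "u \<le> u'"
  have "count c u \<le> count c' u"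
  proof (induction u)
    case (Suc u)
    with c[of u] show ?case by auto
  qed simp
  also have "\<dots> \<le> count c' u'" using \<open>u \<le> u'\<close> by (induction rule: dec_induct) auto
  finally show ?thesis .
qed

lemma count_cong: "(\<And>s. s < u \<Longrightarrow> c s = c' s) \<Longrightarrow> count c u = count c' u"
  by (induction u) auto

lemma last_mark_cong: "(\<And>s. s < u \<Longrightarrow> c s = c' s) \<Longrightarrow> last_mark c u = last_mark c' u"
  by (induction u) auto

lemma last_mark_le: "last_mark c u \<le> u"
  by (induction u) auto

text \<open>The count grows exactly at marks, so the first stage with value \<open>m\<close> comes
  right after the \<open>m\<close>-th mark, or is 0 for \<open>m = 0\<close>; this is the shifted
  position kept by \<open>last_mark\<close>. A search can therefore find the final track.\<close>

lemma last_mark_eq_first: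
  assumes "count c s = m" "\<And>v. v < s \<Longrightarrow> count c v \<noteq> m" "s \<le> u" "count c u = m"
  shows "last_mark c u = s"
  using assms(3,4)
proof (induction rule: dec_induct)
  case base
  then show ?case using assms(2) assms(1) by (cases s) (auto split: if_splits)
next
  case (step u)
  have "m \<le> count c u" using count_mono[of c c s u] step(1) assms(1) by simp
  with step show ?case by (auto split: if_splits)
qed

text \<open>
  The \<open>n\<close>-th part of an element of \<open>Q\<close> has a sequence of marks and a track for every possible position of
  the last mark (\<open>0\<close> if there is none yet, \<open>Suc s\<close> for a mark at \<open>s\<close>). The level \<open>m\<close> is the number of
  marks. At stage \<open>u\<close> only the track belonging to the last mark before \<open>u\<close> is constrained.
\<close>

definition marks :: "baire \<Rightarrow> nat \<Rightarrow> baire" where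
  "marks y n = (\<lambda>s. y (prod_encode (n, prod_encode (0, s))))"

definition track :: "baire \<Rightarrow> nat \<Rightarrow> nat \<Rightarrow> baire" where
  "track y n j = (\<lambda>t. y (prod_encode (n, prod_encode (Suc j, t))))"

text \<open>\<open>advice n\<close> and \<open>level n m\<close> stand for the columns
  \<open>a\<^sub>n\<close> and \<open>(n, m)\<close>. Both are nonzero, which leaves column 0 for
  the limit case of \<open>P\<close>.\<close>

definition advice :: "nat \<Rightarrow> nat" where
  "advice n = prod_encode (Suc n, 0)"

definition level :: "nat \<Rightarrow> nat \<Rightarrow> nat" where
  "level n m = prod_encode (Suc n, Suc m)"

definition Q_clause :: "baire \<Rightarrow> nat \<times> nat \<Rightarrow> bool" where
  "Q_clause y z \<longleftrightarrow> count (marks y (fst z)) (snd z) \<le> fst z \<and>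
    satisfies (snd z) (level (fst z) (count (marks y (fst z)) (snd z)))
      (track y (fst z) (last_mark (marks y (fst z)) (snd z)))"

definition Q_class :: "baire set" where
  "Q_class = {y. (\<forall>n. y n \<le> 1) \<and> (\<forall>z. Q_clause y z)}"

text \<open>
  The number \<open>n\<close> named by an element of \<open>P\<close> is the first nonzero position of component \<open>0\<close>, and \<open>m\<close> is
  the number of nonzero positions below \<open>n\<close> in component \<open>3\<close>, so that \<open>m \<le> n\<close> holds automatically.
\<close>

definition component :: "baire \<Rightarrow> nat \<Rightarrow> baire" where
  "component w j = (\<lambda>t. w (prod_encode (j, t)))"

text \<open>While no number is named, component 1 has to respect the bits of column 0. Naming
  \<open>n\<close> releases it from stage \<open>Suc n\<close> on, so that only its values below
  \<open>n\<close> remain constrained.\<close>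

definition P_clause :: "baire \<Rightarrow> nat \<Rightarrow> bool" where
  "P_clause w u \<longleftrightarrow> ((\<forall>s<u. component w 0 s = 0) \<longrightarrow> satisfies u 0 (component w 1)) \<and>
    (\<forall>n<u. (\<forall>s<n. component w 0 s = 0) \<and> component w 0 n \<noteq> 0 \<longrightarrow>
      satisfies u (advice n) (component w 2) \<and>
      satisfies u (level n (count (component w 3) n)) (component w 4))"

definition P_class :: "baire set" where
  "P_class = {w. (\<forall>n. w n \<le> 1) \<and> (\<forall>u. P_clause w u)}"

text \<open>A presentation of Pi-0-1 classes by decidable conditions on the whole sequence, in which
  conditions on both halves of a tensor product can be conjoined.\<close>

definition normal_class :: "baire set \<Rightarrow> bool" where
  "normal_class A \<longleftrightarrow> (\<exists>D :: baire \<Rightarrow> nat \<Rightarrow> bool. decidable_on UNIV D \<and>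
    A = {f. (\<forall>n. f n \<le> 1) \<and> (\<forall>x. D f x)})"

lemma normal_classI:
  fixes D :: "baire \<Rightarrow> 'e::encodable \<Rightarrow> bool"
  assumes "decidable_on UNIV D"
  shows "normal_class {f. (\<forall>n. f n \<le> 1) \<and> (\<forall>x. D f x)}"
proof -
  have "decidable_on UNIV (\<lambda>f (k :: nat). D f (unenc k))"
    by (rule decidable_on_comp[OF assms]) (intro comp_intros)
  moreover have "(\<forall>x. D f x) \<longleftrightarrow> (\<forall>k. D f (unenc k))" for f
    by (metis unenc_enc)
  ultimately show ?thesis unfolding normal_class_def by auto
qed

lemma normal_class_Pi01: "normal_class A \<Longrightarrow> Pi01_class A"
  unfolding normal_class_def using Pi01_class_decidable by blast

definition evens :: "baire \<Rightarrow> baire" where "evens g = (\<lambda>n. g (2 * n))"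
definition odds :: "baire \<Rightarrow> baire" where "odds g = (\<lambda>n. g (Suc (2 * n)))"

lemma evens_interleave [simp]: "evens (interleave f g) = f"
  by (simp add: evens_def interleave_def)

lemma odds_interleave [simp]: "odds (interleave f g) = g"
  by (simp add: odds_def interleave_def)

lemma interleave_evens_odds [simp]: "interleave (evens g) (odds g) = g"
  by (auto simp: evens_def odds_def interleave_def fun_eq_iff)

lemma tensor_eq: "tensor A B = {g. evens g \<in> A \<and> odds g \<in> B}"
  unfolding tensor_def by auto (metis interleave_evens_odds)

lemma computable_on_evens: "computable_on G evens"
  unfolding evens_def by (intro comp_intros)

lemma computable_on_odds: "computable_on G odds"
  unfolding odds_def by (intro comp_intros)

lemma normal_class_tensor:
  assumes "normal_class A" "normal_class B"
  shows "normal_class (tensor A B)"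
proof -
  obtain D E :: "baire \<Rightarrow> nat \<Rightarrow> bool" where D: "decidable_on UNIV D" "decidable_on UNIV E"
    and AB: "A = {f. (\<forall>n. f n \<le> 1) \<and> (\<forall>x. D f x)}" "B = {f. (\<forall>n. f n \<le> 1) \<and> (\<forall>x. E f x)}"
    using assms unfolding normal_class_def by blast
  have bin: "(\<forall>n. evens g n \<le> 1) \<and> (\<forall>n. odds g n \<le> 1) \<longleftrightarrow> (\<forall>n. g n \<le> 1)" for g
    unfolding evens_def odds_def by (metis evenE oddE Suc_eq_plus1)
  have DE: "decidable_on UNIV (\<lambda>g x. D (evens g) x \<and> E (odds g) x)"
    by (rule decidable_on_conj[OF decidable_on_subst[OF D(1) computable_on_evens]
        decidable_on_subst[OF D(2) computable_on_odds]])
  have "tensor A B = {g. (\<forall>n. g n \<le> 1) \<and> (\<forall>x. D (evens g) x \<and> E (odds g) x)}"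
    unfolding tensor_eq AB using bin by blast
  then show ?thesis using normal_classI[OF DE] by simp
qed

lemma normal_class_solutions: "normal_class (solutions i)"
  unfolding solutions_def by (rule normal_classI) (intro comp_intros)

lemma normal_class_Q: "normal_class Q_class"
  unfolding Q_class_def
proof (rule normal_classI)
  show "decidable_on UNIV Q_clause"
    unfolding Q_clause_def marks_def track_def level_def by (intro comp_intros)
qed

lemma normal_class_P: "normal_class P_class"
  unfolding P_class_def
proof (rule normal_classI)
  show "decidable_on UNIV P_clause"
    unfolding P_clause_def component_def level_def advice_def by (intro comp_intros)
qed

section \<open>The upper bound\<close>

text \<open>Components 0 to 4 of a member of \<open>P\<close> that names \<open>n\<close> and level
  \<open>m\<close>. Only the values of \<open>r\<close> below \<open>n\<close> enter, a finite
  table; the track is the one in force when level \<open>m\<close> is first reached.\<close>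

definition translation :: "nat \<Rightarrow> baire \<Rightarrow> nat \<Rightarrow> baire \<Rightarrow> baire" where
  "translation n r m g c = (let j = fst (prod_decode c); t = snd (prod_decode c) in
    if j = 0 then (if t = n then 1 else 0)
    else if j = 1 then (if t \<in> {..<n} then r t else 0)
    else if j = 2 then odds g t
    else if j = 3 then (if t < m then 1 else 0)
    else if j = 4 then track (evens g) n (LEAST u. count (marks (evens g) n) u = m) t
    else 0)"

text \<open>The promise that level \<open>m\<close> is reached makes the search for its first stage
  terminate.\<close>

lemma computable_on_translation:
  "computable_on {g. \<exists>u. count (marks (evens g) n) u = m} (translation n r m)"
proof -
  let ?G = "{g. \<exists>u. count (marks (evens g) n) u = m}"
  have r: "computable_on ?G (\<lambda>g t. if t \<in> {..<n} then r t else 0)"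
    by (rule computable_on_finite_exceptions) (simp, intro comp_intros)
  have L: "computable_on ?G (\<lambda>g (c :: nat). LEAST u. count (marks (evens g) n) u = m)"
  proof (rule computable_on_Least)
    show "decidable_on ?G (\<lambda>g z. count (marks (evens g) n) (snd z) = m)"
      unfolding marks_def evens_def by (intro comp_intros)
  qed auto
  have r: "computable_on ?G (\<lambda>g c. if snd (prod_decode c) \<in> {..<n} then r (snd (prod_decode c)) else 0)"
    by (rule computable_on_comp[OF r]) (intro comp_intros)
  have "computable_on ?G (\<lambda>g c. translation n r m g c)"
    unfolding translation_def track_def marks_def evens_def odds_def Let_def
    by (intro L[unfolded marks_def evens_def] r[unfolded marks_def evens_def] comp_intros)
  then show ?thesis .
qed

lemma component_translation:
  "component (translation n r m g) 0 = (\<lambda>t. if t = n then 1 else 0)"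
  "component (translation n r m g) 1 = (\<lambda>t. if t < n then r t else 0)"
  "component (translation n r m g) 2 = odds g"
  "component (translation n r m g) 3 = (\<lambda>t. if t < m then 1 else 0)"
  "component (translation n r m g) 4 = track (evens g) n (LEAST u. count (marks (evens g) n) u = m)"
  by (auto simp: component_def translation_def fun_eq_iff)

lemma count_below: "m \<le> n \<Longrightarrow> count (\<lambda>t. if t < m then 1 else 0) n = m"
proof -
  assume "m \<le> n"
  then have "count (\<lambda>t. if t < m then 1 else 0) n = count (\<lambda>t. if t < m then 1 else 0) m"
    by (induction rule: dec_induct) auto
  also have "\<dots> = count (\<lambda>_. 1) m" by (rule count_cong) simp
  also have "\<dots> = m" by (induction m) auto
  finally show ?thesis .
qed

lemma translation_in_P:
  assumes r: "r \<in> solutions 0" and g: "g \<in> tensor Q_class (solutions (advice n))"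
    and m: "\<And>u. u0 \<le> u \<Longrightarrow> count (marks (evens g) n) u = m"
  shows "translation n r m g \<in> P_class"
proof -
  define c where "c = marks (evens g) n"
  define s where "s = (LEAST u. count c u = m)"
  have Q: "\<And>z. Q_clause (evens g) z" and bin: "\<And>k. evens g k \<le> 1" "\<And>k. odds g k \<le> 1"
    and advice: "\<And>u. satisfies u (advice n) (odds g)"
    using g unfolding tensor_eq Q_class_def solutions_def by auto
  have m': "count c u = m" if "u0 \<le> u" for u using m[OF that] by (simp add: c_def)
  have s: "count c s = m" "\<And>v. v < s \<Longrightarrow> count c v \<noteq> m"
    unfolding s_def using m'[of u0] by (auto intro: LeastI dest: not_less_Least)
  have "m \<le> n" using Q[of "(n, u0)"] m'[of u0] by (simp add: Q_clause_def c_def)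
  have track: "satisfies u (level n m) (track (evens g) n s)" for u
  proof -
    \<comment> \<open>At \<open>v\<close> the level \<open>m\<close> is final and its track in
      force, so the clause of \<open>Q\<close> at \<open>v \<ge> u\<close> gives the constraint for
      \<open>u\<close>.\<close>
    define v where "v = max u (max s u0)"
    have "last_mark c v = s" "count c v = m"
      using last_mark_eq_first[OF s, of v] m'[of v] by (simp_all add: v_def)
    then have "satisfies v (level n m) (track (evens g) n s)"
      using Q[of "(n, v)"] by (simp add: Q_clause_def c_def)
    then show ?thesis by (rule satisfies_antimono) (simp add: v_def)
  qed
  have "P_clause (translation n r m g) u" for u
  proof -
    \<comment> \<open>If no number is named before \<open>u\<close> then \<open>u \<le> n\<close>,
      and below \<open>u\<close> component 1 coincides with \<open>r\<close>.\<close>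
    have "satisfies u 0 (\<lambda>t. if t < n then r t else 0)" if "\<forall>s<u. s \<noteq> n"
    proof -
      from that have "u \<le> n" by (metis not_le)
      then have "satisfies u 0 (\<lambda>t. if t < n then r t else 0) \<longleftrightarrow> satisfies u 0 r"
        by (intro satisfies_cong) simp
      with r show ?thesis by (simp add: solutions_def)
    qed
    then show ?thesis
      unfolding P_clause_def component_translation
      using advice track count_below[OF \<open>m \<le> n\<close>] by (auto simp: s_def c_def)
  qed
  moreover have "translation n r m g k \<le> 1" for k
    using r bin by (auto simp: translation_def Let_def track_def solutions_def)
  ultimately show ?thesis unfolding P_class_def by blast
qed

text \<open>Each change strictly increases \<open>f\<close>, so the values right after changes are
  distinct members of \<open>{0<..n}\<close>.\<close>

lemma bounded_mono_changes:
  fixes f :: "nat \<Rightarrow> nat"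
  assumes "mono f" "\<And>l. f l \<le> n"
  shows "finite {l. f (l + 1) \<noteq> f l} \<and> card {l. f (l + 1) \<noteq> f l} \<le> n"
proof -
  let ?S = "{l. f (l + 1) \<noteq> f l}"
  have less: "f l < f (Suc l)" if "l \<in> ?S" for l
    using that monoD[OF assms(1), of l "Suc l"] by simp
  have "inj_on (\<lambda>l. f (Suc l)) ?S"
  proof (rule inj_onI)
    have lt: False if "k \<in> ?S" "l \<in> ?S" "f (Suc k) = f (Suc l)" "k < l" for k l
      using less[OF that(2)] monoD[OF assms(1), of "Suc k" l] that by simp
    fix k l assume "k \<in> ?S" "l \<in> ?S" "f (Suc k) = f (Suc l)"
    with lt[of k l] lt[of l k] show "k = l" by (metis linorder_neqE_nat)
  qed
  moreover have "(\<lambda>l. f (Suc l)) ` ?S \<subseteq> {0<..n}"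
    using less assms(2) by fastforce
  ultimately show ?thesis
    using card_inj_on_le[of "\<lambda>l. f (Suc l)" ?S "{0<..n}"]
      inj_on_finite[of "\<lambda>l. f (Suc l)" ?S "{0<..n}"] by simp
qed

text \<open>Marks that the string does not yet show read as 0, that is, as absent.\<close>

definition pad :: "nat list \<Rightarrow> baire" where
  "pad \<sigma> k = (if k < length \<sigma> then hd (drop k \<sigma>) else 0)"

lemma pad_initial: "pad (g \<restriction> l) k = (if k < l then g k else 0)"
  by (simp add: pad_def hd_drop_conv_nth)

text \<open>The learner counts the visible marks of part \<open>n\<close> and guesses the index of
  the translation for that level. The count only grows and never exceeds \<open>n\<close>, which
  bounds mind changes, guesses and indices at once.\<close>

lemma upper_bound:
  assumes r: "r \<in> solutions 0"
  defines "B \<equiv> \<lambda>n. tensor Q_class (solutions (advice n))"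
  shows "reducible comp_bounded_changes P_class (B n)"
    and "reducible comp_bounded_guesses P_class (B n)"
    and "reducible comp_finitely_many P_class (B n)"
proof -
  define final where "final g = Max (range (count (marks (evens g) n)))" for g
  have bounded: "count (marks (evens g) n) u \<le> n" if "g \<in> B n" for g u
  proof -
    from that have "Q_clause (evens g) (n, u)" by (simp add: B_def tensor_eq Q_class_def)
    then show ?thesis by (simp add: Q_clause_def)
  qed
  have final: "final g \<le> n" "\<exists>u0. \<forall>u\<ge>u0. count (marks (evens g) n) u = final g" if "g \<in> B n" for g
  proof -
    let ?R = "range (count (marks (evens g) n))"
    have R: "finite ?R" "?R \<noteq> {}"
      using bounded[OF that] by (auto intro: finite_subset[of _ "{..n}"])
    then have "final g \<in> ?R" unfolding final_def by (rule Max_in)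
    then obtain u0 where u0: "count (marks (evens g) n) u0 = final g" by auto
    have "count (marks (evens g) n) u = final g" if "u0 \<le> u" for u
    proof (rule antisym)
      show "count (marks (evens g) n) u \<le> final g" unfolding final_def using R by simp
      show "final g \<le> count (marks (evens g) n) u"
        unfolding u0[symmetric] by (rule count_mono) (use that in auto)
    qed
    then show "\<exists>u0. \<forall>u\<ge>u0. count (marks (evens g) n) u = final g" by blast
    show "final g \<le> n" using bounded[OF that, of u0] u0 by simp
  qed
  have "\<exists>p. \<forall>g. (\<exists>u. count (marks (evens g) n) u = m) \<longrightarrow>
      (\<forall>x. run p g x = Some (translation n r m g x))" for m
    using computable_on_translation[of n m r] unfolding computable_on_def by simp
  then obtain p where p: "\<And>m g u x. count (marks (evens g) n) u = m \<Longrightarrow>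
      run (p m) g x = Some (translation n r m g x)" by metis
  \<comment> \<open>Indices of the chosen programs, a finite table padded with 0 and hence
    computable.\<close>
  define a where "a m = (if m \<in> {..n} then code (p m) else 0)" for m
  \<comment> \<open>Cutting down to \<open>B n\<close> makes the bounds, known on
    \<open>B n\<close>, hold on the whole domain.\<close>
  define \<Gamma> where "\<Gamma> g = (if g \<in> B n then Phi (a (final g)) g else None)" for g
  have Phi: "Phi (a (final g)) g = Some (translation n r (final g) g)" if "g \<in> B n" for g
  proof -
    have "\<And>x. run (p (final g)) g x = Some (translation n r (final g) g x)"
      using p final(2)[OF that] by blast
    then show ?thesis
      using final(1)[OF that] by (simp add: Phi_def functional_def a_def)
  qed
  have dom: "dom \<Gamma> = B n" by (auto simp: \<Gamma>_def Phi split: if_splits)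
  have red: "reducible C P_class (B n)" if "C \<Gamma>" for C
  proof -
    have "the (\<Gamma> g) \<in> P_class" if "g \<in> B n" for g
      using translation_in_P[OF r] final(2)[OF that] that by (auto simp: \<Gamma>_def Phi B_def)
    with that dom show ?thesis unfolding reducible_def by blast
  qed
  have "\<forall>g\<in>dom \<Gamma>. \<exists>e < Suc (Max (a ` {..n})). \<Gamma> g = Phi e g"
  proof
    fix g assume "g \<in> dom \<Gamma>"
    then have g: "g \<in> B n" using dom by simp
    then have "a (final g) \<le> Max (a ` {..n})" using final(1)[OF g] by simp
    with g show "\<exists>e < Suc (Max (a ` {..n})). \<Gamma> g = Phi e g"
      by (intro exI[of _ "a (final g)"]) (simp add: \<Gamma>_def)
  qed
  then show "reducible comp_finitely_many P_class (B n)"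
    by (intro red) (auto simp: comp_finitely_many_def)
  define seen where "seen g l = count (marks (evens (pad (g \<restriction> l))) n) l" for g l
  define \<Psi> where "\<Psi> \<sigma> = a (count (marks (evens (pad \<sigma>)) n) (length \<sigma>))" for \<sigma>
  have \<Psi>_seen: "\<Psi> (g \<restriction> l) = a (seen g l)" for g l by (simp add: \<Psi>_def seen_def)
  have mono: "mono (seen g)" for g
  proof (rule monoI)
    fix k l :: nat assume "k \<le> l"
    then show "seen g k \<le> seen g l"
      unfolding seen_def by (intro count_mono) (auto simp: marks_def evens_def pad_initial split: if_splits)
  qed
  have le: "seen g l \<le> count (marks (evens g) n) l" for g l
    unfolding seen_def by (rule count_mono) (auto simp: marks_def evens_def pad_initial split: if_splits)
  have le_n: "seen g l \<le> n" if "g \<in> B n" for g l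
    using le bounded[OF that] le_trans by blast
  have eventually: "\<exists>l0. \<forall>l\<ge>l0. seen g l = final g" if g: "g \<in> B n" for g
  proof -
    obtain u0 where u0: "\<forall>u\<ge>u0. count (marks (evens g) n) u = final g"
      using final(2)[OF g] by blast
    \<comment> \<open>From length \<open>L\<close> on, the string shows every mark below
      \<open>u0\<close>; \<open>evens\<close> reads position \<open>2 * c\<close> for
      \<open>c\<close>.\<close>
    define L where "L = Max (insert u0 ((\<lambda>s. Suc (2 * prod_encode (n, prod_encode (0, s)))) ` {..<u0}))"
    have L: "u0 \<le> L" "\<And>s. s < u0 \<Longrightarrow> 2 * prod_encode (n, prod_encode (0, s)) < L"
      unfolding L_def by (auto simp: Max_ge_iff less_eq_Suc_le)
    have "seen g l = final g" if "L \<le> l" for l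
    proof (rule antisym)
      show "seen g l \<le> final g" using le[of g l] u0 L(1) that by simp
      have "final g = count (marks (evens g) n) u0" using u0 by simp
      also have "\<dots> = count (marks (evens (pad (g \<restriction> l))) n) u0"
      proof (rule count_cong)
        fix s assume "s < u0"
        with L(2)[of s] that show "marks (evens g) n s = marks (evens (pad (g \<restriction> l))) n s"
          by (simp add: marks_def evens_def pad_initial)
      qed
      also have "\<dots> \<le> seen g l"
        unfolding seen_def by (rule count_mono) (use L(1) that in auto)
      finally show "final g \<le> seen g l" .
    qed
    then show ?thesis by blast
  qed
  have "computable_on UNIV (\<lambda>g m. if m \<in> {..n} then code (p m) else 0)"
    by (rule computable_on_finite_exceptions) (simp, intro comp_intros)
  then have a: "computable_on UNIV (\<lambda>g. a)" by (simp add: a_def[abs_def])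
  have "computable_on UNIV (\<lambda>g. \<Psi>)"
    unfolding \<Psi>_def[abs_def] marks_def evens_def pad_def
    by (rule computable_on_comp[OF a]) (intro comp_intros)
  then have comp: "computable_on_strings \<Psi>"
    unfolding computable_on_def computable_on_strings_def by (simp add: enc_nat_list) blast
  have ident: "identified_by \<Gamma> \<Psi>"
    unfolding identified_by_def dom
  proof
    fix g assume g: "g \<in> B n"
    then obtain l0 where "\<forall>l\<ge>l0. seen g l = final g" using eventually by blast
    with g show "\<exists>e. (\<exists>m. \<forall>n\<ge>m. \<Psi> (g \<restriction> n) = e) \<and> Phi e g = \<Gamma> g"
      by (intro exI[of _ "a (final g)"] conjI exI[of _ l0]) (auto simp: \<Psi>_seen \<Gamma>_def)
  qed
  have "finite (mind_changes \<Psi> g) \<and> card (mind_changes \<Psi> g) \<le> n" if "g \<in> dom \<Gamma>" for g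
  proof -
    have "mind_changes \<Psi> g \<subseteq> {l. seen g (l + 1) \<noteq> seen g l}"
      unfolding mind_changes_def \<Psi>_seen by auto
    with bounded_mono_changes[OF mono[of g] le_n] that dom show ?thesis
      by (metis (no_types, lifting) card_mono finite_subset le_trans)
  qed
  with comp ident show "reducible comp_bounded_changes P_class (B n)"
    by (intro red) (auto simp: comp_bounded_changes_def)
  have "finite (guesses \<Psi> g) \<and> card (guesses \<Psi> g) \<le> Suc n" if "g \<in> dom \<Gamma>" for g
  proof -
    have sub: "guesses \<Psi> g \<subseteq> a ` {..n}"
      unfolding guesses_def \<Psi>_seen using le_n that dom by auto
    then have "card (guesses \<Psi> g) \<le> card (a ` {..n})" by (intro card_mono) auto
    also have "\<dots> \<le> Suc n" using card_image_le[of "{..n}" a] by simp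
    finally show ?thesis using sub finite_subset by blast
  qed
  with comp ident show "reducible comp_bounded_guesses P_class (B n)"
    by (intro red) (unfold comp_bounded_guesses_def, blast)
qed

section \<open>Weak reducibility\<close>

text \<open>
  All three reducibilities imply this one, in which \<open>F\<close> is continuous on each of the finitely many sets of
  constant colour \<open>\<chi>\<close>. Unlike the notions themselves, it is closed under
  composition without any programming.
\<close>

definition wred :: "baire set \<Rightarrow> baire set \<Rightarrow> bool" where
  "wred A B \<longleftrightarrow> (\<exists>F (\<chi> :: baire \<Rightarrow> nat). finite (\<chi> ` B) \<and> (\<forall>g\<in>B. F g \<in> A \<and> turing_le (F g) g \<and>
    (\<forall>N. \<exists>L. \<forall>g'\<in>B. \<chi> g' = \<chi> g \<and> (\<forall>i<L. g' i = g i) \<longrightarrow> (\<forall>i<N. F g' i = F g i))))"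

text \<open>A derivation reads only a finite part of the oracle.\<close>

lemma run_use:
  assumes "run p g x = Some y"
  shows "\<exists>L. \<forall>g'. (\<forall>i<L. g' i = g i) \<longrightarrow> run p g' x = Some y"
proof -
  from assms have "run p (omit_column 0 g) x = Some y" by simp
  from run_derivable[OF this] obtain d n where d: "valid 0 (g \<restriction> n) d" "(code p, x, y) \<in> set d"
    unfolding derivable_def by blast
  have "run p g' x = Some y" if "\<forall>i<n. g' i = g i" for g'
    using valid_sound[OF d(1), of g'] d(2) that by fastforce
  then show ?thesis by blast
qed

lemma Phi_run: "Phi e g = Some w \<Longrightarrow> run (prog e) g x = Some (w x)"
  unfolding Phi_def functional_def by (auto split: if_splits)

lemma Phi_use:
  assumes "Phi e g = Some w"
  shows "\<exists>L. \<forall>g' w'. (\<forall>i<L. g' i = g i) \<longrightarrow> Phi e g' = Some w' \<longrightarrow> (\<forall>i<N. w' i = w i)"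
proof -
  have "\<exists>L. \<forall>g'. (\<forall>i<L. g' i = g i) \<longrightarrow> run (prog e) g' x = Some (w x)" for x
    by (rule run_use) (rule Phi_run[OF assms])
  then obtain L where L: "\<And>x g'. (\<forall>i<L x. g' i = g i) \<Longrightarrow> run (prog e) g' x = Some (w x)" by metis
  have le: "L x \<le> Max (L ` {..N})" if "x < N" for x using that by simp
  show ?thesis
  proof (intro exI allI impI)
    fix g' w' x assume g': "\<forall>i<Max (L ` {..N}). g' i = g i" "Phi e g' = Some w'" "x < N"
    then have "run (prog e) g' x = Some (w x)" using L[of x g'] le[of x] by (meson less_le_trans)
    with Phi_run[OF g'(2)] show "w' x = w x" by simp
  qed
qed

text \<open>Computation with a fixed index is continuous, so it is enough that the index is locally
  constant within each colour.\<close>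

lemma wredI:
  fixes \<chi> :: "baire \<Rightarrow> nat"
  assumes dom: "B \<subseteq> dom \<Gamma>" and A: "\<And>g. g \<in> B \<Longrightarrow> the (\<Gamma> g) \<in> A"
    and e: "\<And>g. g \<in> B \<Longrightarrow> \<Gamma> g = Phi (e g) g"
    and fin: "finite (\<chi> ` B)"
    and index: "\<And>g. g \<in> B \<Longrightarrow>
      \<exists>L. \<forall>g'\<in>B. \<chi> g' = \<chi> g \<and> (\<forall>i<L. g' i = g i) \<longrightarrow> e g' = e g"
  shows "wred A B"
proof -
  define F where "F g = the (\<Gamma> g)" for g
  have F: "Phi (e g) g = Some (F g)" if "g \<in> B" for g
    using dom that unfolding F_def e[OF that, symmetric] by (metis domIff option.collapse subsetD)
  have "turing_le (F g) g" if "g \<in> B" for g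
    unfolding turing_le_iff_run using Phi_run[OF F[OF that]] by blast
  moreover have "\<exists>L. \<forall>g'\<in>B. \<chi> g' = \<chi> g \<and> (\<forall>i<L. g' i = g i) \<longrightarrow> (\<forall>i<N. F g' i = F g i)"
    if g: "g \<in> B" for g N
  proof -
    obtain L where L: "\<And>g'. g' \<in> B \<Longrightarrow> \<chi> g' = \<chi> g \<Longrightarrow> (\<forall>i<L. g' i = g i) \<Longrightarrow> e g' = e g"
      using index[OF g] by blast
    obtain M where M: "\<And>g' w'. (\<forall>i<M. g' i = g i) \<Longrightarrow> Phi (e g) g' = Some w' \<Longrightarrow> (\<forall>i<N. w' i = F g i)"
      using Phi_use[OF F[OF g], of N] by blast
    have "\<forall>i<N. F g' i = F g i" if g': "g' \<in> B" "\<chi> g' = \<chi> g" "\<forall>i<max L M. g' i = g i" for g'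
    proof (rule M)
      show "\<forall>i<M. g' i = g i" using g'(3) by simp
      have "e g' = e g" using L g' by simp
      then show "Phi (e g) g' = Some (F g')" using F[OF g'(1)] by simp
    qed
    then show ?thesis by blast
  qed
  moreover have "F g \<in> A" if "g \<in> B" for g using A[OF that] by (simp add: F_def)
  ultimately show ?thesis
    unfolding wred_def using fin by (intro exI[of _ F] exI[of _ \<chi>] conjI ballI allI)
qed

lemma wred_if_finitely_many:
  assumes "reducible comp_finitely_many A B"
  shows "wred A B"
proof -
  obtain \<Gamma> b where dom: "B \<subseteq> dom \<Gamma>" "\<forall>g\<in>B. the (\<Gamma> g) \<in> A"
    and "\<forall>g\<in>dom \<Gamma>. \<exists>e<b. \<Gamma> g = Phi e g"
    using assms unfolding reducible_def comp_finitely_many_def by blast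
  then obtain e where e: "\<And>g. g \<in> B \<Longrightarrow> e g < b \<and> \<Gamma> g = Phi (e g) g"
    by (metis subsetD)
  show ?thesis
  proof (rule wredI[OF dom(1), where e = e and \<chi> = e])
    show "finite (e ` B)" by (rule finite_subset[of _ "{..<b}"]) (use e in auto)
  qed (use dom e in auto)
qed

text \<open>Inputs of equal colour that agree up to the first appearance of the final guess share
  that guess: an earlier or later first appearance would change its rank.\<close>

lemma wred_if_bounded_guesses:
  assumes "reducible comp_bounded_guesses A B"
  shows "wred A B"
proof -
  obtain \<Gamma> \<Psi> k where dom: "B \<subseteq> dom \<Gamma>" "\<forall>g\<in>B. the (\<Gamma> g) \<in> A"
    and ident: "identified_by \<Gamma> \<Psi>"
    and k: "\<forall>g\<in>dom \<Gamma>. finite (guesses \<Psi> g) \<and> card (guesses \<Psi> g) \<le> k"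
    using assms unfolding reducible_def comp_bounded_guesses_def by blast
  from ident dom(1) obtain e where e: "\<And>g. g \<in> B \<Longrightarrow>
      (\<exists>m. \<forall>n\<ge>m. \<Psi> (g \<restriction> n) = e g) \<and> Phi (e g) g = \<Gamma> g"
    unfolding identified_by_def by (metis subsetD)
  define first where "first g = (LEAST n. \<Psi> (g \<restriction> n) = e g)" for g
  define before where "before g n = (\<lambda>l. \<Psi> (g \<restriction> l)) ` {..<n}" for g n
  \<comment> \<open>The colour of \<open>g\<close> is the rank of its final guess among the distinct guesses, ordered by
    first appearance.\<close>
  define \<chi> where "\<chi> g = card (before g (first g))" for g
  have first: "\<Psi> (g \<restriction> first g) = e g" if "g \<in> B" for g
  proof -
    have "\<exists>n. \<Psi> (g \<restriction> n) = e g" using e[OF that] by blast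
    then show ?thesis unfolding first_def by (rule LeastI_ex)
  qed
  have new: "e g \<notin> before g (first g)" for g
    unfolding before_def first_def using not_less_Least by fastforce
  show ?thesis
  proof (rule wredI[OF dom(1), where e = e and \<chi> = \<chi>])
    have "\<chi> g \<le> k" if "g \<in> B" for g
    proof -
      have g: "finite (guesses \<Psi> g)" "card (guesses \<Psi> g) \<le> k" using k dom(1) that by auto
      have "before g (first g) \<subseteq> guesses \<Psi> g" by (auto simp: before_def guesses_def)
      then show ?thesis unfolding \<chi>_def using g card_mono le_trans by blast
    qed
    then have "\<chi> ` B \<subseteq> {..k}" by blast
    then show "finite (\<chi> ` B)" by (rule finite_subset) simp
    fix g assume g: "g \<in> B"
    have same: "e g' = e g"
      if g': "g' \<in> B" "\<chi> g' = \<chi> g" "first g' \<le> first g" "\<And>n. n \<le> first g \<Longrightarrow> g' \<restriction> n = g \<restriction> n"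
      for g'
    proof (cases "first g' = first g")
      case True
      then show ?thesis using first[OF g] first[OF g'(1)] g'(4) by simp
    next
      case False
      with g'(3) have less: "first g' < first g" by simp
      have "before g' (first g') = before g (first g')"
        unfolding before_def using less g'(4) by (intro image_cong) auto
      moreover have "insert (e g') (before g (first g')) \<subseteq> before g (first g)"
        using less first[OF g'(1)] g'(4)[of "first g'"] by (force simp: before_def)
      ultimately have "card (insert (e g') (before g' (first g'))) \<le> \<chi> g"
        unfolding \<chi>_def by (intro card_mono) (simp_all add: before_def)
      moreover have "card (insert (e g') (before g' (first g'))) = Suc (\<chi> g')"
        using new by (simp add: \<chi>_def before_def)
      ultimately show ?thesis using g'(2) by simp
    qed
    show "\<exists>L. \<forall>g'\<in>B. \<chi> g' = \<chi> g \<and> (\<forall>i<L. g' i = g i) \<longrightarrow> e g' = e g"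
    proof (intro exI ballI impI)
      fix g' assume g': "g' \<in> B" "\<chi> g' = \<chi> g \<and> (\<forall>i<first g. g' i = g i)"
      then have eq: "g' \<restriction> n = g \<restriction> n" if "n \<le> first g" for n
        using that by (auto simp: initial_def)
      show "e g' = e g"
      proof (cases "first g' \<le> first g")
        case True
        then show ?thesis using same g' eq by blast
      next
        case False
        have "e g \<in> before g' (first g')"
          using False eq[of "first g"] first[OF g] unfolding before_def by (metis image_eqI lessThan_iff not_le order_refl)
        moreover have "before g (first g) = before g' (first g)"
          unfolding before_def using eq by (intro image_cong) auto
        moreover have "e g \<notin> before g (first g)" by (rule new)
        ultimately have "before g (first g) \<subset> before g' (first g')"
          using False by (auto simp: before_def)
        then have "\<chi> g < \<chi> g'" unfolding \<chi>_def by (rule psubset_card_mono[rotated]) (simp add: before_def)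
        with g' show ?thesis by simp
      qed
    qed
  qed (use dom e in auto)
qed

lemma bounded_guesses_if_bounded_changes:
  assumes "comp_bounded_changes \<Gamma>"
  shows "comp_bounded_guesses \<Gamma>"
proof -
  obtain \<Psi> k where \<Psi>: "computable_on_strings \<Psi>" "identified_by \<Gamma> \<Psi>"
    and k: "\<forall>g\<in>dom \<Gamma>. finite (mind_changes \<Psi> g) \<and> card (mind_changes \<Psi> g) \<le> k"
    using assms unfolding comp_bounded_changes_def by blast
  have "finite (guesses \<Psi> g) \<and> card (guesses \<Psi> g) \<le> Suc k" if "g \<in> dom \<Gamma>" for g
  proof -
    let ?S = "insert (\<Psi> (g \<restriction> 0)) ((\<lambda>n. \<Psi> (g \<restriction> (n + 1))) ` mind_changes \<Psi> g)"
    have "\<Psi> (g \<restriction> n) \<in> ?S" for n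
    proof (induction n)
      case (Suc n)
      show ?case
      proof (cases "n \<in> mind_changes \<Psi> g")
        case True
        then show ?thesis by auto
      next
        case False
        then have "\<Psi> (g \<restriction> Suc n) = \<Psi> (g \<restriction> n)" by (simp add: mind_changes_def)
        with Suc show ?thesis by simp
      qed
    qed simp
    then have sub: "guesses \<Psi> g \<subseteq> ?S" unfolding guesses_def by blast
    have fin: "finite (mind_changes \<Psi> g)" "card (mind_changes \<Psi> g) \<le> k" using k that by auto
    then have "card ?S \<le> Suc k"
      using card_image_le[OF fin(1), of "\<lambda>n. \<Psi> (g \<restriction> (n + 1))"]
      by (simp add: card_insert_if)
    with sub fin(1) show ?thesis
      using card_mono[OF _ sub] finite_subset[OF sub] by auto
  qed
  with \<Psi> show ?thesis unfolding comp_bounded_guesses_def by blast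
qed

lemma wred_if_bounded_changes: "reducible comp_bounded_changes A B \<Longrightarrow> wred A B"
  using bounded_guesses_if_bounded_changes wred_if_bounded_guesses unfolding reducible_def by blast

section \<open>Composition and products of weak reductions\<close>

lemma wred_trans:
  assumes "wred A B" "wred B C"
  shows "wred A C"
proof -
  obtain F1 and \<chi>1 :: "baire \<Rightarrow> nat" where fin1: "finite (\<chi>1 ` B)"
    and 1: "\<And>g. g \<in> B \<Longrightarrow> F1 g \<in> A" "\<And>g. g \<in> B \<Longrightarrow> turing_le (F1 g) g"
    and cont1: "\<And>g N. g \<in> B \<Longrightarrow> \<exists>L. \<forall>g'\<in>B. \<chi>1 g' = \<chi>1 g \<and> (\<forall>i<L. g' i = g i) \<longrightarrow> (\<forall>i<N. F1 g' i = F1 g i)"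
    using assms(1) unfolding wred_def by blast
  obtain F2 and \<chi>2 :: "baire \<Rightarrow> nat" where fin2: "finite (\<chi>2 ` C)"
    and 2: "\<And>g. g \<in> C \<Longrightarrow> F2 g \<in> B" "\<And>g. g \<in> C \<Longrightarrow> turing_le (F2 g) g"
    and cont2: "\<And>g N. g \<in> C \<Longrightarrow> \<exists>L. \<forall>g'\<in>C. \<chi>2 g' = \<chi>2 g \<and> (\<forall>i<L. g' i = g i) \<longrightarrow> (\<forall>i<N. F2 g' i = F2 g i)"
    using assms(2) unfolding wred_def by blast
  \<comment> \<open>The colour of the intermediate point is included, because \<open>F1\<close> is
    continuous only within its own colours.\<close>
  define \<chi> where "\<chi> g = prod_encode (\<chi>2 g, \<chi>1 (F2 g))" for g
  have "\<chi> ` C \<subseteq> prod_encode ` (\<chi>2 ` C \<times> \<chi>1 ` B)"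
    using 2(1) by (auto simp: \<chi>_def)
  then have "finite (\<chi> ` C)" by (rule finite_subset) (intro finite_imageI finite_cartesian_product fin1 fin2)
  moreover have "F1 (F2 g) \<in> A \<and> turing_le (F1 (F2 g)) g" if "g \<in> C" for g
    using 1 2 that turing_le_trans by blast
  moreover have "\<exists>L. \<forall>g'\<in>C. \<chi> g' = \<chi> g \<and> (\<forall>i<L. g' i = g i) \<longrightarrow> (\<forall>i<N. F1 (F2 g') i = F1 (F2 g) i)"
    if g: "g \<in> C" for g N
  proof -
    obtain M where M: "\<forall>g'\<in>B. \<chi>1 g' = \<chi>1 (F2 g) \<and> (\<forall>i<M. g' i = F2 g i) \<longrightarrow> (\<forall>i<N. F1 g' i = F1 (F2 g) i)"
      using cont1[OF 2(1)[OF g]] by blast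
    obtain L where L: "\<forall>g'\<in>C. \<chi>2 g' = \<chi>2 g \<and> (\<forall>i<L. g' i = g i) \<longrightarrow> (\<forall>i<M. F2 g' i = F2 g i)"
      using cont2[OF g] by blast
    have "\<forall>i<N. F1 (F2 g') i = F1 (F2 g) i" if "g' \<in> C" "\<chi> g' = \<chi> g" "\<forall>i<L. g' i = g i" for g'
      using M L that 2(1)[OF that(1)] by (simp add: \<chi>_def)
    then show ?thesis by blast
  qed
  ultimately show ?thesis
    unfolding wred_def by (intro exI[of _ "\<lambda>g. F1 (F2 g)"] exI[of _ \<chi>]) blast
qed

lemma turing_le_interleave:
  assumes "turing_le f g" "turing_le h g"
  shows "turing_le (interleave f h) g"
proof -
  have half: "computable_on {g} (\<lambda>_ n. k (n div 2))" if "turing_le k g" for k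
    by (rule computable_on_comp[OF that[unfolded turing_le_def]]) (intro comp_intros)
  have "computable_on {g} (\<lambda>_ n. if n mod 2 = 0 then f (n div 2) else h (n div 2))"
    by (intro computable_on_if half assms comp_intros)
  then show ?thesis
    unfolding turing_le_def interleave_def even_iff_mod_2_eq_zero .
qed

lemma turing_le_evens: "turing_le (evens g) g"
  by (rule turing_leI[OF computable_on_evens]) simp

lemma turing_le_odds: "turing_le (odds g) g"
  by (rule turing_leI[OF computable_on_odds]) simp

lemma wred_tensor:
  assumes "wred A A'" "wred B B'"
  shows "wred (tensor A B) (tensor A' B')"
proof -
  obtain F1 and \<chi>1 :: "baire \<Rightarrow> nat" where fin1: "finite (\<chi>1 ` A')"
    and 1: "\<And>g. g \<in> A' \<Longrightarrow> F1 g \<in> A" "\<And>g. g \<in> A' \<Longrightarrow> turing_le (F1 g) g"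
    and cont1: "\<And>g N. g \<in> A' \<Longrightarrow> \<exists>L. \<forall>g'\<in>A'. \<chi>1 g' = \<chi>1 g \<and> (\<forall>i<L. g' i = g i) \<longrightarrow> (\<forall>i<N. F1 g' i = F1 g i)"
    using assms(1) unfolding wred_def by blast
  obtain F2 and \<chi>2 :: "baire \<Rightarrow> nat" where fin2: "finite (\<chi>2 ` B')"
    and 2: "\<And>g. g \<in> B' \<Longrightarrow> F2 g \<in> B" "\<And>g. g \<in> B' \<Longrightarrow> turing_le (F2 g) g"
    and cont2: "\<And>g N. g \<in> B' \<Longrightarrow> \<exists>L. \<forall>g'\<in>B'. \<chi>2 g' = \<chi>2 g \<and> (\<forall>i<L. g' i = g i) \<longrightarrow> (\<forall>i<N. F2 g' i = F2 g i)"
    using assms(2) unfolding wred_def by blast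
  define \<chi> where "\<chi> g = prod_encode (\<chi>1 (evens g), \<chi>2 (odds g))" for g
  define F where "F g = interleave (F1 (evens g)) (F2 (odds g))" for g
  have "\<chi> ` tensor A' B' \<subseteq> prod_encode ` (\<chi>1 ` A' \<times> \<chi>2 ` B')"
    by (auto simp: \<chi>_def tensor_eq)
  then have "finite (\<chi> ` tensor A' B')"
    by (rule finite_subset) (intro finite_imageI finite_cartesian_product fin1 fin2)
  moreover have "F g \<in> tensor A B \<and> turing_le (F g) g" if "g \<in> tensor A' B'" for g
    using that 1(1) 2(1) unfolding tensor_eq F_def
    by (auto intro!: turing_le_interleave turing_le_trans[OF 1(2) turing_le_evens]
        turing_le_trans[OF 2(2) turing_le_odds])
  moreover have "\<exists>L. \<forall>g'\<in>tensor A' B'. \<chi> g' = \<chi> g \<and> (\<forall>i<L. g' i = g i) \<longrightarrow> (\<forall>i<N. F g' i = F g i)"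
    if g: "g \<in> tensor A' B'" for g N
  proof -
    have mem: "evens g \<in> A'" "odds g \<in> B'" using g by (auto simp: tensor_eq)
    obtain K where K: "\<forall>g'\<in>A'. \<chi>1 g' = \<chi>1 (evens g) \<and> (\<forall>i<K. g' i = evens g i) \<longrightarrow> (\<forall>i<N. F1 g' i = F1 (evens g) i)"
      using cont1[OF mem(1)] by blast
    obtain L where L: "\<forall>g'\<in>B'. \<chi>2 g' = \<chi>2 (odds g) \<and> (\<forall>i<L. g' i = odds g i) \<longrightarrow> (\<forall>i<N. F2 g' i = F2 (odds g) i)"
      using cont2[OF mem(2)] by blast
    have "\<forall>i<N. F g' i = F g i"
      if g': "g' \<in> tensor A' B'" "\<chi> g' = \<chi> g" "\<forall>i<2 * (K + L). g' i = g i" for g'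
    proof -
      have "\<forall>i<K. evens g' i = evens g i" "\<forall>i<L. odds g' i = odds g i"
        using g'(3) by (auto simp: evens_def odds_def)
      then have "\<forall>i<N. F1 (evens g') i = F1 (evens g) i" "\<forall>i<N. F2 (odds g') i = F2 (odds g) i"
        using K L g'(1,2) by (auto simp: \<chi>_def tensor_eq)
      then show ?thesis by (auto simp: F_def interleave_def)
    qed
    then show ?thesis by blast
  qed
  ultimately show ?thesis
    unfolding wred_def by (intro exI[of _ F] exI[of _ \<chi>]) blast
qed

section \<open>From reducibilities to degree structures\<close>

lemma reducible_refl:
  "reducible comp_bounded_changes A A" "reducible comp_bounded_guesses A A"
  "reducible comp_finitely_many A A"
proof -
  let ?\<Psi> = "\<lambda>_ :: nat list. code Oracle"
  have Phi: "Phi (code Oracle) g = Some g" for g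
    by (simp add: Phi_def functional_def del: code.simps)
  have \<Psi>: "computable_on_strings ?\<Psi>"
    unfolding computable_on_strings_def by (rule exI[of _ "const_prog (code Oracle)"]) simp
  have "identified_by Some ?\<Psi>" unfolding identified_by_def using Phi by auto
  moreover have "mind_changes ?\<Psi> g = {}" for g by (simp add: mind_changes_def)
  moreover have "guesses ?\<Psi> g = {code Oracle}" for g by (auto simp: guesses_def)
  ultimately have "comp_bounded_changes Some" "comp_bounded_guesses Some"
    unfolding comp_bounded_changes_def comp_bounded_guesses_def using \<Psi>
    by (metis card.empty finite.emptyI order_refl, metis finite.emptyI finite.insertI order_refl)
  moreover have "comp_finitely_many Some"
    unfolding comp_finitely_many_def using Phi by (metis lessI)
  ultimately show "reducible comp_bounded_changes A A" "reducible comp_bounded_guesses A A"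
    "reducible comp_finitely_many A A"
    unfolding reducible_def by auto
qed

text \<open>Order and join of degrees involve arbitrary representatives. Each change of
  representative costs one reduction, and all of them are composed as instances of
  \<open>wred\<close>.\<close>

lemma not_Brouwerian_degree_structure:
  assumes refl: "\<And>A. reducible C A A" and weak: "\<And>A B. reducible C A B \<Longrightarrow> wred A B"
    and X: "P \<in> X" "Q \<in> X" "\<And>n. R n \<in> X" "\<And>n. tensor Q (R n) \<in> X"
    and upper: "\<And>n. reducible C P (tensor Q (R n))"
    and lower: "\<And>U. wred P (tensor Q U) \<Longrightarrow> (\<And>n. wred U (R n)) \<Longrightarrow> False"
  shows "\<not> Brouwerian (degree_structure X C)"
proof
  let ?L = "degree_structure X C"
  define cls where "cls A = equiv_rel X (reducible C) `` {A}" for A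
  have cls: "B \<in> cls A \<longleftrightarrow> A \<in> X \<and> B \<in> X \<and> reducible C A B \<and> reducible C B A" for A B
    by (simp add: cls_def equiv_rel_def)
  have self: "A \<in> X \<Longrightarrow> A \<in> cls A" for A by (simp add: cls refl)
  have carrier: "A \<in> X \<Longrightarrow> cls A \<in> carrier ?L" for A
    by (simp add: degree_structure_def cls_def quotientI)
  have le: "le ?L p q \<longleftrightarrow> (\<exists>A\<in>p. \<exists>B\<in>q. reducible C A B)" for p q
    by (simp add: degree_structure_def)
  have vee: "vee ?L p q = (\<Union>A\<in>p. \<Union>B\<in>q. cls (tensor A B))" for p q
    by (simp add: degree_structure_def cls_def)
  assume "Brouwerian ?L"
  then obtain r where r: "least ?L r {r \<in> carrier ?L. le ?L (cls P) (vee ?L (cls Q) r)}"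
    unfolding Brouwerian_def using carrier X(1,2) by blast
  then have r1: "r \<in> carrier ?L" "le ?L (cls P) (vee ?L (cls Q) r)"
    and r2: "\<And>s. s \<in> carrier ?L \<Longrightarrow> le ?L (cls P) (vee ?L (cls Q) s) \<Longrightarrow> le ?L r s"
    by (auto simp: least_def)
  from r1(1) obtain U where U: "U \<in> X" "r = cls U"
    by (auto simp: degree_structure_def cls_def elim!: quotientE)
  have "wred P (tensor Q U)"
  proof -
    from r1(2) obtain A B Q' U' where *: "A \<in> cls P" "Q' \<in> cls Q" "U' \<in> cls U"
      "B \<in> cls (tensor Q' U')" "reducible C A B"
      unfolding le vee U(2) by blast
    then have "wred P A" "wred A B" "wred B (tensor Q' U')" "wred (tensor Q' U') (tensor Q U)"
      by (auto simp: cls intro: weak wred_tensor)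
    then show ?thesis by (blast intro: wred_trans)
  qed
  moreover have "wred U (R n)" for n
  proof -
    have "le ?L (cls P) (vee ?L (cls Q) (cls (R n)))"
      unfolding le vee using self X upper by blast
    from r2[OF carrier[OF X(3)] this] obtain A B where "A \<in> cls U" "B \<in> cls (R n)" "reducible C A B"
      unfolding le U(2) by blast
    then have "wred U A" "wred A B" "wred B (R n)" by (auto simp: cls intro: weak)
    then show ?thesis by (blast intro: wred_trans)
  qed
  ultimately show False by (rule lower)
qed

section \<open>The lower bound\<close>

lemma count_last_mark_unmarked:
  assumes "s \<le> u" "\<And>v. s \<le> v \<Longrightarrow> v < u \<Longrightarrow> c v = 0"
  shows "count c u = count c s" "last_mark c u = last_mark c s"
proof -
  have "count c u = count c s \<and> last_mark c u = last_mark c s"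
    using assms by (induction rule: dec_induct) auto
  then show "count c u = count c s" "last_mark c u = last_mark c s" by auto
qed

lemma turing_le_component: "turing_le (component w j) w"
  by (rule turing_leI[where F = "\<lambda>g t. g (prod_encode (j, t))"])
    (intro comp_intros, simp add: component_def)

section \<open>Members of \<open>Q\<close> computed from few columns\<close>

locale independent =
  fixes X :: baire
  assumes X_bin: "X P \<le> 1"
    and X_decided: "(P, v) \<in> set (decided u) \<Longrightarrow> X P = v"
    and X_independent: "turing_le h (omit_column (Suc i) X) \<Longrightarrow>
      \<exists>u t v. (prod_encode (i, t), v) \<in> set (decided u) \<and> h t \<noteq> v"
begin

definition column :: "nat \<Rightarrow> baire" where
  "column i t = X (prod_encode (i, t))"

lemma satisfies_column: "satisfies u i (column i)"
proof -
  have "column i (snd (prod_decode P)) = v"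
    if "(P, v) \<in> set (decided u)" "fst (prod_decode P) = i" for P v
    using X_decided[OF that(1)] that(2) by (metis column_def prod.collapse prod_decode_inverse)
  then show ?thesis unfolding satisfies_def by auto
qed

lemma column_solution: "column i \<in> solutions i"
  using X_bin satisfies_column by (simp add: solutions_def column_def)

lemma not_satisfies:
  assumes "turing_le h (omit_column (Suc i) X)"
  shows "\<exists>u. \<not> satisfies u i h"
proof -
  obtain u t v where "(prod_encode (i, t), v) \<in> set (decided u)" "h t \<noteq> v"
    using X_independent[OF assms] by blast
  then show ?thesis unfolding satisfies_def by (intro exI[of _ u]) force
qed

lemma column_below: "j \<noteq> i \<Longrightarrow> turing_le (column j) (omit_column (Suc i) X)"
  by (rule turing_leI[where F = "\<lambda>g t. g (prod_encode (j, t))"])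
    (intro comp_intros, auto simp: omit_column_def column_def)

text \<open>
  Up to finitely many places, \<open>standard n m s\<close> is the element of \<open>Q\<close> that is at level \<open>m\<close> in part \<open>n\<close>, on
  track \<open>s\<close>, and at level \<open>0\<close> in all other parts.
\<close>

definition standard :: "nat \<Rightarrow> nat \<Rightarrow> nat \<Rightarrow> baire" where
  "standard n m s c = (let j = fst (prod_decode c); k = fst (prod_decode (snd (prod_decode c)));
      t = snd (prod_decode (snd (prod_decode c))) in
    if k = 0 then 0
    else if j = n then (if k = Suc s then column (level n m) t else 0)
    else if k = 1 then column (level j 0) t else 0)"

lemma level_inj [simp]: "level n m = level n' m' \<longleftrightarrow> n = n' \<and> m = m'"
  by (auto simp: level_def)

lemma advice_neq [simp]:
  "advice n \<noteq> level n' m" "level n' m \<noteq> advice n" "advice n \<noteq> 0" "level n m \<noteq> 0"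
  "0 \<noteq> advice n" "0 \<noteq> level n m" "advice n = advice n' \<longleftrightarrow> n = n'"
  using le_prod_encode_1[of "Suc n" 0] le_prod_encode_1[of "Suc n" "Suc m"]
  by (auto simp: level_def advice_def)

text \<open>The program queries only column \<open>level n m\<close> and the columns
  \<open>level j 0\<close> with \<open>j \<noteq> n\<close>, none of which is blanked.\<close>

lemma standard_below:
  assumes "i \<noteq> level n m" "\<And>j. j \<noteq> n \<Longrightarrow> i \<noteq> level j 0"
  shows "turing_le (standard n m s) (omit_column (Suc i) X)"
proof (rule turing_leI)
  let ?F = "\<lambda>(g :: baire) c. let j = fst (prod_decode c); k = fst (prod_decode (snd (prod_decode c)));
      t = snd (prod_decode (snd (prod_decode c))) in
    if k = 0 then 0
    else if j = n then (if k = Suc s then g (prod_encode (level n m, t)) else 0)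
    else if k = 1 then g (prod_encode (level j 0, t)) else 0"
  show "computable_on {omit_column (Suc i) X} ?F"
    unfolding Let_def level_def by (intro comp_intros)
  show "?F (omit_column (Suc i) X) = standard n m s"
    using assms by (auto simp: fun_eq_iff standard_def Let_def omit_column_def column_def)
qed

text \<open>The finite difference from \<open>standard\<close> limits the columns from which
  \<open>y\<close> is computed; the absence of marks from \<open>s\<close> on leaves room to raise
  the level.\<close>

definition at_level :: "nat \<Rightarrow> nat \<Rightarrow> baire \<Rightarrow> nat \<Rightarrow> bool" where
  "at_level n m y s \<longleftrightarrow> y \<in> Q_class \<and> finite {c. y c \<noteq> standard n m s c} \<and>
    count (marks y n) s = m \<and> last_mark (marks y n) s = s \<and> (\<forall>v\<ge>s. marks y n v = 0) \<and>
    (\<forall>j c. j \<noteq> n \<longrightarrow> y (prod_encode (j, c)) = standard n m s (prod_encode (j, c)))"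

lemma at_level_below:
  assumes "at_level n m y s" "i \<noteq> level n m" "\<And>j. j \<noteq> n \<Longrightarrow> i \<noteq> level j 0"
  shows "turing_le y (omit_column (Suc i) X)"
  using turing_le_finite_difference[OF _ standard_below[OF assms(2,3)]] assms(1)
  unfolding at_level_def by blast

lemma at_level_0: "at_level n 0 (standard n 0 0) 0"
proof -
  have marks: "marks (standard n 0 0) j = (\<lambda>_. 0)" for j
    by (simp add: marks_def standard_def fun_eq_iff)
  have zero: "count (\<lambda>_. 0) u = 0" "last_mark (\<lambda>_. 0) u = 0" for u
    by (induction u) auto
  have track: "track (standard n 0 0) j 0 = column (level j 0)" for j
    by (simp add: track_def standard_def fun_eq_iff)
  have "Q_clause (standard n 0 0) z" for z
    by (simp add: Q_clause_def marks zero track satisfies_column)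
  moreover have "standard n 0 0 c \<le> 1" for c
    using X_bin by (simp add: standard_def Let_def column_def)
  ultimately have "standard n 0 0 \<in> Q_class" unfolding Q_class_def by blast
  then show ?thesis by (simp add: at_level_def marks zero)
qed

text \<open>A new mark at a place not below \<open>s\<close> or \<open>L\<close> switches to a fresh
  track holding column \<open>level n (Suc m)\<close>. Clauses before the switch read only what is
  kept of \<open>y\<close>.\<close>

lemma at_level_Suc:
  assumes y: "at_level n m y s" and "m < n"
  shows "\<exists>y' s'. at_level n (Suc m) y' s' \<and> (\<forall>i<L. y' i = y i)"
proof -
  define s1 where "s1 = max s L"
  \<comment> \<open>A mark at \<open>s1\<close> selects track \<open>Suc s1\<close>, stored under
    index \<open>Suc (Suc s1)\<close>. The other tracks are cut off at \<open>s1\<close>, which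
    leaves a finite difference from the new standard element.\<close>
  define y' where "y' c = (let j = fst (prod_decode c); k = fst (prod_decode (snd (prod_decode c)));
      t = snd (prod_decode (snd (prod_decode c))) in
    if j \<noteq> n then y c
    else if k = 0 then (if t = s1 then 1 else y c)
    else if k = Suc (Suc s1) then column (level n (Suc m)) t
    else if t < s1 then y c else 0)" for c
  have yQ: "\<And>z. Q_clause y z" "\<And>c. y c \<le> 1" and fin: "finite {c. y c \<noteq> standard n m s c}"
    and count_s: "count (marks y n) s = m" and last_s: "last_mark (marks y n) s = s"
    and unmarked: "\<And>v. s \<le> v \<Longrightarrow> marks y n v = 0"
    and other: "\<And>j c. j \<noteq> n \<Longrightarrow> y (prod_encode (j, c)) = standard n m s (prod_encode (j, c))"
    using y unfolding at_level_def Q_class_def by auto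
  have marks': "marks y' n v = (if v = s1 then 1 else marks y n v)" for v
    by (simp add: marks_def y'_def)
  have track': "track y' n a t = (if a = Suc s1 then column (level n (Suc m)) t
      else if t < s1 then track y n a t else 0)" for a t
    by (simp add: track_def y'_def)
  have other': "marks y' j = marks y j" "track y' j = track y j" if "j \<noteq> n" for j
    using that by (simp_all add: marks_def track_def y'_def fun_eq_iff)
  have early: "count (marks y' n) u = count (marks y n) u" "last_mark (marks y' n) u = last_mark (marks y n) u"
    if "u \<le> s1" for u
    using that by (intro count_cong last_mark_cong; simp add: marks')+
  have s1: "count (marks y n) s1 = m"
    using count_last_mark_unmarked(1)[of s s1 "marks y n"] unmarked count_s by (simp add: s1_def)
  have late: "count (marks y' n) u = Suc m" "last_mark (marks y' n) u = Suc s1" if "Suc s1 \<le> u" for u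
  proof -
    have "marks y' n v = 0" if "Suc s1 \<le> v" for v
      using that unmarked[of v] by (simp add: marks' s1_def)
    with count_last_mark_unmarked[OF that, of "marks y' n"]
    have "count (marks y' n) u = count (marks y' n) (Suc s1)"
      "last_mark (marks y' n) u = last_mark (marks y' n) (Suc s1)" by auto
    then show "count (marks y' n) u = Suc m" "last_mark (marks y' n) u = Suc s1"
      using early(1)[of s1] s1 by (auto simp: marks')
  qed
  have "Q_clause y' (j, u)" for j u
  proof (cases "j = n")
    case False
    then show ?thesis using yQ(1)[of "(j, u)"] by (simp add: Q_clause_def other')
  next
    case True
    show ?thesis
    proof (cases "u \<le> s1")
      case le: True
      \<comment> \<open>Up to stage \<open>s1\<close> the track in force is not the new one, and
        only its values below \<open>u \<le> s1\<close> are read.\<close>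
      have "satisfies u i (track y' n (last_mark (marks y n) u)) \<longleftrightarrow>
          satisfies u i (track y n (last_mark (marks y n) u))" for i
        using last_mark_le[of "marks y n" u] le by (intro satisfies_cong) (auto simp: track')
      with yQ(1)[of "(n, u)"] show ?thesis by (simp add: Q_clause_def True early[OF le])
    next
      case False
      then have "Suc s1 \<le> u" by simp
      moreover have "track y' n (Suc s1) = column (level n (Suc m))"
        by (simp add: track' fun_eq_iff)
      ultimately show ?thesis
        using \<open>m < n\<close> by (simp add: Q_clause_def True late satisfies_column)
    qed
  qed
  moreover have "y' c \<le> 1" for c
    using yQ(2) X_bin by (simp add: y'_def Let_def column_def)
  ultimately have "y' \<in> Q_class" unfolding Q_class_def by auto
  moreover have "finite {c. y' c \<noteq> standard n (Suc m) (Suc s1) c}"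
  proof (rule finite_subset)
    let ?E = "{c. y c \<noteq> standard n m s c} \<union> {prod_encode (n, prod_encode (0, s1))} \<union>
      (\<lambda>t. prod_encode (n, prod_encode (Suc s, t))) ` {..<s1}"
    show "finite ?E" using fin by simp
    show "{c. y' c \<noteq> standard n (Suc m) (Suc s1) c} \<subseteq> ?E"
    proof
      fix c assume "c \<in> {c. y' c \<noteq> standard n (Suc m) (Suc s1) c}"
      moreover obtain j k t where c: "c = prod_encode (j, prod_encode (k, t))"
        by (metis prod_decode_inverse surj_pair)
      ultimately show "c \<in> ?E"
        by (auto simp: y'_def standard_def split: if_splits)
    qed
  qed
  moreover have "count (marks y' n) (Suc s1) = Suc m" "last_mark (marks y' n) (Suc s1) = Suc s1"
    by (rule late[OF order_refl])+
  moreover have "\<forall>v\<ge>Suc s1. marks y' n v = 0" using unmarked by (simp add: marks' s1_def)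
  moreover have "y' (prod_encode (j, c)) = standard n (Suc m) (Suc s1) (prod_encode (j, c))"
    if "j \<noteq> n" for j c
    using other[OF that, of c] that by (simp add: y'_def standard_def Let_def)
  ultimately have "at_level n (Suc m) y' (Suc s1)" unfolding at_level_def by blast
  moreover have "y' c = y c" if "c < L" for c
  proof -
    \<comment> \<open>Components of a code do not exceed it, so positions below \<open>L\<close>
      avoid the new mark, the new track and the cut.\<close>
    obtain j k t where c: "c = prod_encode (j, prod_encode (k, t))"
      by (metis prod_decode_inverse surj_pair)
    have "prod_encode (k, t) \<le> c" unfolding c by (rule le_prod_encode_2)
    then have "k < L" "t < L"
      using that le_prod_encode_1[of k t] le_prod_encode_2[of t k] by linarith+
    then show ?thesis by (auto simp: y'_def c s1_def)
  qed
  ultimately show ?thesis by blast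
qed

text \<open>The level is raised from 0 to \<open>n\<close>, the number of colours. Near
  \<open>y\<close> and within its colour, continuity freezes the level named by the output, whereas
  raising the level forces another name; so each raise excludes one more colour.\<close>

lemma lower_bound:
  assumes P: "wred P_class (tensor Q_class U)" and U: "\<And>n. wred U (solutions (advice n))"
  shows False
proof -
  obtain F and \<chi> :: "baire \<Rightarrow> nat" where fin: "finite (\<chi> ` tensor Q_class U)"
    and F: "\<And>g. g \<in> tensor Q_class U \<Longrightarrow> F g \<in> P_class"
      "\<And>g. g \<in> tensor Q_class U \<Longrightarrow> turing_le (F g) g"
    and cont: "\<And>g N. g \<in> tensor Q_class U \<Longrightarrow> \<exists>L. \<forall>g'\<in>tensor Q_class U.
      \<chi> g' = \<chi> g \<and> (\<forall>i<L. g' i = g i) \<longrightarrow> (\<forall>i<N. F g' i = F g i)"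
    using P unfolding wred_def by blast
  define C where "C = \<chi> ` tensor Q_class U"
  define n where "n = card C"
  \<comment> \<open>The reduction of \<open>U\<close> to \<open>solutions (advice n)\<close> is
    applied to column \<open>advice n\<close>.\<close>
  obtain h where h: "h \<in> U" "turing_le h (column (advice n))"
    using U[of n] column_solution unfolding wred_def by blast
  define tag where "tag y = count (component (F (interleave y h)) 3) n" for y
  have mem: "interleave y h \<in> tensor Q_class U" if "at_level n m y s" for m y s
    using that h(1) by (simp add: at_level_def tensor_eq)
  \<comment> \<open>The output is computed from the columns \<open>advice n\<close>,
    \<open>level n m\<close> and \<open>level j 0\<close> with \<open>j \<noteq> n\<close>. Naming
    no number, another number or another level would yield a solution for a column outside
    these.\<close>
  have tag: "tag y = m" if y: "at_level n m y s" for m y s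
  proof -
    define w where "w = F (interleave y h)"
    have w: "\<And>u. P_clause w u" using F(1)[OF mem[OF y]] by (auto simp: w_def P_class_def)
    have below: "turing_le (component w j) (omit_column (Suc i) X)"
      if "i \<noteq> level n m" "\<And>j. j \<noteq> n \<Longrightarrow> i \<noteq> level j 0" "i \<noteq> advice n" for i j
    proof -
      have "turing_le (interleave y h) (omit_column (Suc i) X)"
        using at_level_below[OF y that(1,2)] turing_le_trans[OF h(2) column_below] that(3)
        by (intro turing_le_interleave) auto
      then show ?thesis
        using turing_le_trans turing_le_component F(2)[OF mem[OF y]] unfolding w_def by metis
    qed
    obtain u0 where u0: "\<not> satisfies u0 0 (component w 1)"
      using not_satisfies[OF below[of 0 1]] by auto
    have "\<exists>s<u0. component w 0 s \<noteq> 0"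
      using w[of u0] u0 by (auto simp: P_clause_def)
    then have ex: "\<exists>s. component w 0 s \<noteq> 0" by blast
    define n' where "n' = (LEAST s. component w 0 s \<noteq> 0)"
    have n': "component w 0 n' \<noteq> 0" "\<forall>s<n'. component w 0 s = 0"
      unfolding n'_def using LeastI_ex[OF ex] not_less_Least by auto
    have sat: "satisfies u (advice n') (component w 2)"
      "satisfies u (level n' (count (component w 3) n')) (component w 4)" for u
    proof -
      from w[of "max u (Suc n')"] n'
      have "satisfies (max u (Suc n')) (advice n') (component w 2)"
        "satisfies (max u (Suc n')) (level n' (count (component w 3) n')) (component w 4)"
        by (auto simp: P_clause_def)
      then show "satisfies u (advice n') (component w 2)"
        "satisfies u (level n' (count (component w 3) n')) (component w 4)"
        by (auto elim: satisfies_antimono)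
    qed
    have "n' = n"
    proof (rule ccontr)
      assume "n' \<noteq> n"
      then show False using not_satisfies[OF below[of "advice n'" 2]] sat(1) by auto
    qed
    have "count (component w 3) n = m"
    proof (rule ccontr)
      assume "count (component w 3) n \<noteq> m"
      then show False
        using not_satisfies[OF below[of "level n (count (component w 3) n)" 4]] sat(2)
        unfolding \<open>n' = n\<close> by auto
    qed
    then show ?thesis by (simp add: tag_def w_def)
  qed
  \<comment> \<open>The first \<open>N\<close> values of the output determine the tag.\<close>
  have "\<exists>N. \<forall>s<n. prod_encode (3, s) < N"
    using finite_nat_set_iff_bounded[of "(\<lambda>s. prod_encode (3, s)) ` {..<n}"] by auto
  then obtain N where N: "\<And>s. s < n \<Longrightarrow> prod_encode (3, s) < N" by blast
  have agree: "interleave y' h i = interleave y h i" if "\<forall>i<L. y' i = y i" "i < L" for y y' i L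
    using that by (simp add: interleave_def)
  \<comment> \<open>\<open>D\<close> holds \<open>m\<close> colours that are impossible for elements
    of level at least \<open>m\<close> agreeing with \<open>y\<close> below
    \<open>L\<close>.\<close>
  have "m \<le> n \<Longrightarrow> \<exists>y s D L. at_level n m y s \<and> D \<subseteq> C \<and> card D = m \<and>
      (\<forall>m' y' s'. m \<le> m' \<and> at_level n m' y' s' \<and> (\<forall>i<L. y' i = y i) \<longrightarrow>
        \<chi> (interleave y' h) \<notin> D)" for m
  proof (induction m)
    case 0
    show ?case using at_level_0[of n] by (intro exI[of _ "standard n 0 0"] exI[of _ 0] exI[of _ "{}"]) simp
  next
    case (Suc m)
    from Suc.IH[OF Suc_leD[OF Suc.prems]]
    obtain y s D L where y: "at_level n m y s" and D: "D \<subseteq> C" "card D = m"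
      and L: "\<And>m' y' s'. m \<le> m' \<Longrightarrow> at_level n m' y' s' \<Longrightarrow> (\<forall>i<L. y' i = y i) \<Longrightarrow>
        \<chi> (interleave y' h) \<notin> D"
      by blast
    define c where "c = \<chi> (interleave y h)"
    have c: "c \<in> C" "c \<notin> D" using mem[OF y] L[OF order_refl y] by (auto simp: c_def C_def)
    obtain M where M: "\<forall>g'\<in>tensor Q_class U. \<chi> g' = c \<and> (\<forall>i<M. g' i = interleave y h i) \<longrightarrow>
        (\<forall>i<N. F g' i = F (interleave y h) i)"
      using cont[OF mem[OF y], of N] unfolding c_def by blast
    define L' where "L' = max L M"
    obtain y' s' where y': "at_level n (Suc m) y' s'" "\<forall>i<L'. y' i = y i"
      using at_level_Suc[OF y, of L'] Suc.prems by auto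
    have new: "\<chi> (interleave z h) \<notin> insert c D"
      if z: "Suc m \<le> m'" "at_level n m' z r" "\<forall>i<L'. z i = y' i" for m' z r
    proof -
      have zy: "\<forall>i<L'. z i = y i" using z(3) y'(2) by simp
      have "\<chi> (interleave z h) \<noteq> c"
      proof
        assume "\<chi> (interleave z h) = c"
        moreover have "\<forall>i<M. interleave z h i = interleave y h i"
          using agree[of M z y] zy by (simp add: L'_def)
        ultimately have eq: "\<forall>i<N. F (interleave z h) i = F (interleave y h) i"
          using M mem[OF z(2)] by blast
        have "tag z = tag y"
          unfolding tag_def by (rule count_cong) (use eq N in \<open>simp add: component_def\<close>)
        then show False using tag[OF y] tag[OF z(2)] z(1) by simp
      qed
      moreover have "\<chi> (interleave z h) \<notin> D"
        using L[of m' z r] z zy by (simp add: L'_def)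
      ultimately show ?thesis by simp
    qed
    have D': "insert c D \<subseteq> C" "card (insert c D) = Suc m"
      using c D fin finite_subset[OF D(1)] by (auto simp: C_def)
    show ?case
    proof (rule exI[of _ y'], rule exI[of _ s'], rule exI[of _ "insert c D"], rule exI[of _ L'],
        intro conjI allI impI y'(1) D')
      fix m' z r assume "Suc m \<le> m' \<and> at_level n m' z r \<and> (\<forall>i<L'. z i = y' i)"
      then show "\<chi> (interleave z h) \<notin> insert c D" by (elim conjE) (rule new)
    qed
  qed
  from this[OF order_refl] obtain y s D L where y: "at_level n n y s" and D: "D \<subseteq> C" "card D = n"
    and L: "\<And>m' y' s'. n \<le> m' \<Longrightarrow> at_level n m' y' s' \<Longrightarrow> (\<forall>i<L. y' i = y i) \<Longrightarrow>
      \<chi> (interleave y' h) \<notin> D"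
    by blast
  \<comment> \<open>All \<open>n\<close> colours are excluded, yet \<open>y\<close> has one.\<close>
  have "D = C" using card_subset_eq[OF _ D(1)] D(2) fin by (simp add: n_def C_def)
  moreover have "\<chi> (interleave y h) \<in> C" using mem[OF y] by (simp add: C_def)
  ultimately show False using L[OF order_refl y] by simp
qed

section \<open>Nonemptiness and the degree structures\<close>

lemma Q_class_nonempty: "Q_class \<noteq> {}"
  using at_level_0 unfolding at_level_def by blast

text \<open>The limit case: no number is named, and component 1 is column 0.\<close>

lemma P_class_nonempty: "P_class \<noteq> {}"
proof -
  define w where "w c = (if fst (prod_decode c) = 1 then column 0 (snd (prod_decode c)) else 0)" for c
  have "component w 0 = (\<lambda>_. 0)" "component w 1 = column 0"
    by (auto simp: component_def w_def)
  then have "P_clause w u" for u by (simp add: P_clause_def satisfies_column)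
  moreover have "w c \<le> 1" for c using X_bin by (simp add: w_def column_def)
  ultimately have "w \<in> P_class" unfolding P_class_def by blast
  then show ?thesis by blast
qed

lemma not_Brouwerian:
  fixes C :: "(baire \<rightharpoonup> baire) \<Rightarrow> bool"
  assumes "\<And>A. reducible C A A" "\<And>A B. reducible C A B \<Longrightarrow> wred A B"
    and "\<And>n. reducible C P_class (tensor Q_class (solutions (advice n)))"
  shows "\<not> Brouwerian (D_degrees C)" "\<not> Brouwerian (P_degrees C)"
proof -
  have X: "P_class \<in> X \<Longrightarrow> Q_class \<in> X \<Longrightarrow> (\<And>n. solutions (advice n) \<in> X) \<Longrightarrow>
      (\<And>n. tensor Q_class (solutions (advice n)) \<in> X) \<Longrightarrow> \<not> Brouwerian (degree_structure X C)" for X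
    by (rule not_Brouwerian_degree_structure[OF assms(1,2) _ _ _ _ assms(3) lower_bound])
  show "\<not> Brouwerian (D_degrees C)" unfolding D_degrees_def by (rule X) auto
  have "tensor Q_class (solutions (advice n)) \<noteq> {}" for n
    using Q_class_nonempty column_solution by (force simp: tensor_def)
  then show "\<not> Brouwerian (P_degrees C)"
    unfolding P_degrees_def
    using P_class_nonempty Q_class_nonempty column_solution
    by (intro X) (auto intro!: normal_class_Pi01 normal_class_tensor normal_class_P normal_class_Q
        normal_class_solutions)
qed

end

theorem theorem82:
  shows "\<not> Brouwerian (D_degrees comp_bounded_changes) \<and>
         \<not> Brouwerian (D_degrees comp_bounded_guesses) \<and>
         \<not> Brouwerian (D_degrees comp_finitely_many) \<and>
         \<not> Brouwerian (P_degrees comp_bounded_changes) \<and>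
         \<not> Brouwerian (P_degrees comp_bounded_guesses) \<and>
         \<not> Brouwerian (P_degrees comp_finitely_many)"
proof -
  obtain X where "independent X"
    using independent_columns unfolding independent_def by blast
  then interpret independent X .
  note upper = upper_bound[OF column_solution[of 0]]
  show ?thesis
    using not_Brouwerian[OF reducible_refl(1) wred_if_bounded_changes upper(1)]
      not_Brouwerian[OF reducible_refl(2) wred_if_bounded_guesses upper(2)]
      not_Brouwerian[OF reducible_refl(3) wred_if_finitely_many upper(3)]
    by blast
qed

end
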